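(* Let $C_0,C_1,C_2,\ldots$ be independent and identically distributed complex-valued random variables with absolutely continuous distribution and $\mathbb{E}[|C_0|^t]<\infty$ for some $t>0$, and let $P_n(z)=\sum_{k=0}^nC_kz^k$. Let $w\in\mathbb{T}$, $0<r<2$, and $D_r(w)=\{z\in\mathbb{C}:|z-w|<r\}$. Then the expected number of zeros of $P_n$ in $D_r(w)$ satisfies $$\mathbb{E}\left[n\,\tau_n(D_r(w))\right]=\frac{2\arcsin(r/2)}{\pi}\,n+O\left(\sqrt{n\log n}\right)\quad\text{as } n\to\infty.$$
   Context: $\mathbb{T}=\{z\in\mathbb{C}:|z|=1\}$. "Absolutely continuous" means having a density with respect to area measure on $\mathbb{C}$; in particular $C_0C_n\neq0$ almost surely. $\tau_n=\frac1n\sum_{k=1}^n\delta_{Z_k}$ is the normalized counting measure of the $n$ complex zeros $Z_1,\dots,Z_n$ of $P_n$ (with multiplicity), so $n\tau_n(E)$ is the number of zeros in a set $E$. The implied constant may depend on $r$, $w$ and the distribution of $C_0$. *)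

theory Defs
  imports
    "HOL-Probability.Probability"
    "HOL-Library.Landau_Symbols"
    "HOL-Computational_Algebra.Polynomial"
begin

definition iid_vars :: "'a measure \<Rightarrow> 'b measure \<Rightarrow> (nat \<Rightarrow> 'a \<Rightarrow> 'b) \<Rightarrow> bool" where
  "iid_vars M N X \<longleftrightarrow>
     prob_space.indep_vars M (\<lambda>_. N) X UNIV \<and> (\<forall>k. distr M N (X k) = distr M N (X 0))"

definition random_poly :: "(nat \<Rightarrow> 'a \<Rightarrow> complex) \<Rightarrow> nat \<Rightarrow> 'a \<Rightarrow> complex poly" where
  "random_poly C n \<omega> = (\<Sum>k\<le>n. monom (C k \<omega>) k)"

(* (1/n) * (sum of point masses at the zeros of p), zeros repeated according to multiplicity.
   It is written as the measure with mass (multiplicity of z) / n at each z; it is defined on all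
   subsets of the plane. Since proots 0 is empty, the zero polynomial gets the zero measure. *)
definition zeros_measure :: "nat \<Rightarrow> complex poly \<Rightarrow> complex measure" where
  "zeros_measure n p =
     density (count_space UNIV) (\<lambda>z. ennreal (real (count (proots p) z) / real n))"

lemma sets_zeros_measure [simp]: "sets (zeros_measure n p) = UNIV"
  by (simp add: zeros_measure_def)

lemma emeasure_zeros_measure:
  "emeasure (zeros_measure n p) E = ennreal (real (size (filter_mset (\<lambda>z. z \<in> E) (proots p))) / real n)"
proof -
  let ?A = "set_mset (filter_mset (\<lambda>z. z \<in> E) (proots p))"
  have "emeasure (zeros_measure n p) E =
      (\<integral>\<^sup>+z. ennreal (real (count (proots p) z) / real n) * indicator E z \<partial>count_space UNIV)"
    by (simp add: zeros_measure_def emeasure_density)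
  also have "\<dots> = (\<Sum>z\<in>?A. ennreal (real (count (proots p) z) / real n) * indicator E z)"
    by (rule nn_integral_count_space') (auto simp: indicator_def not_in_iff)
  also have "\<dots> = (\<Sum>z\<in>?A. ennreal (real (count (filter_mset (\<lambda>z. z \<in> E) (proots p)) z) / real n))"
    by (intro sum.cong) auto
  also have "\<dots> = ennreal (\<Sum>z\<in>?A. real (count (filter_mset (\<lambda>z. z \<in> E) (proots p)) z) / real n)"
    by (rule sum_ennreal) auto
  also have "(\<Sum>z\<in>?A. real (count (filter_mset (\<lambda>z. z \<in> E) (proots p)) z) / real n) =
      real (size (filter_mset (\<lambda>z. z \<in> E) (proots p))) / real n"
    by (simp only: size_multiset_overloaded_eq of_nat_sum sum_divide_distrib)
  finally show ?thesis .
qed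

lemma measure_zeros_measure:
  "n > 0 \<Longrightarrow>
     real n * measure (zeros_measure n p) E = real (size (filter_mset (\<lambda>z. z \<in> E) (proots p)))"
  by (simp add: measure_def emeasure_zeros_measure)

end

theory Submission
  imports
    Defs
    "HOL-Computational_Algebra.Fundamental_Theorem_Algebra"
    "HOL-Complex_Analysis.Cauchy_Integral_Formula"
    "HOL-Real_Asymp.Real_Asymp"
begin

text \<open>The zeros of a random polynomial \<open>P\<close> of degree \<open>n\<close> cluster at the unit circle and
equidistribute there because \<open>ln \<bar>P z\<bar>\<close> is, up to \<open>O(log n)\<close> in mean, the potential \<open>n ln max(1,
\<bar>z\<bar>)\<close> of \<open>n\<close> times the uniform measure of the circle. The proof turns this into a count by
comparing Jensen means on two circles centred at \<open>w\<close>, the centre of the disc itself.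

For a polynomial \<open>p\<close> let \<open>L(s)\<close> be the mean of \<open>ln \<bar>p\<bar>\<close> over the circle of radius \<open>s\<close> about \<open>w\<close>,
and \<open>N(s)\<close> the number of zeros in the open disc. The mean of \<open>ln \<bar>z - a\<bar>\<close> over the circle is \<open>ln
max(s, \<bar>w - a\<bar>)\<close>, so for \<open>s' < s\<close> every zero contributes to \<open>L(s) - L(s')\<close> between \<open>0\<close> and
\<open>ln(s/s')\<close>, and \<open>N(s') ln(s/s') \<le> L(s) - L(s') \<le> N(s) ln(s/s')\<close> (\<open>zero_count_log_mean\<close>). The
uniform measure of the unit circle satisfies the same inequalities (\<open>log_plus_mean_diff\<close>), with \<open>2
arcsin(s/2) / \<pi>\<close>, the share of the unit circle inside the disc, in place of \<open>N(s)\<close>. Hence if \<open>B\<close>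
bounds the expected absolute difference of the two potentials, averaged over each of the circles
used, then the expectation of \<open>N(r)\<close> differs from its predicted value by \<open>O(n h + B/h)\<close>, where \<open>h
= s - s'\<close>. With \<open>B = O(log n)\<close> the choice \<open>h = sqrt(log n / n)\<close> gives \<open>O(sqrt(n log n))\<close>.

It remains to bound \<open>E \<bar>ln \<bar>P z\<bar> - n ln max(1, \<bar>z\<bar>)\<bar>\<close> for a fixed \<open>z\<close>, on an event that is likely
enough. The upper bound needs only the moment (\<open>log_norm_poly_le\<close>). The lower bound is an
anti-concentration estimate. The density may be unbounded, so that \<open>E ln \<bar>C 0\<bar>\<close> may be \<open>-\<infinity>\<close>; but
on some set \<open>A\<close> of positive probability it is bounded. As soon as one coefficient falls into \<open>A\<close>,
conditioning on the others leaves a variable with a bounded density, whose distance to any given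
point has a negative logarithmic part of bounded mean; the first such index for \<open>\<bar>z\<bar> \<le> 1\<close>, or the
last one for \<open>\<bar>z\<bar> > 1\<close>, is at a geometrically distributed distance from the dominating end of the
polynomial, so the power of \<open>z\<close> in front of it costs only \<open>O(\<bar>ln \<bar>z\<bar>\<bar>)\<close>
(\<open>neg_log_random_sum_bound\<close>). The event that no coefficient falls into \<open>A\<close> is exponentially
unlikely, and on it the trivial bound \<open>N \<le> n\<close> suffices.

The integral of the statement is a Bochner integral, which vanishes for a function that is not
measurable; so the measurability of the zero count is part of the claim. It comes from Jensen
means again: the count is a limit of difference quotients of \<open>L\<close>
(\<open>measurable_zero_count_random_poly\<close>).\<close>

section \<open>Means of logarithms over circles\<close>

definition angle_measure :: "real measure" where
  "angle_measure = uniform_measure lborel {0..2 * pi}"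

lemma prob_space_angle: "prob_space angle_measure"
  unfolding angle_measure_def by (rule prob_space_uniform_measure) auto

interpretation angle: prob_space angle_measure by (rule prob_space_angle)

lemma sets_angle [simp, measurable_cong]: "sets angle_measure = sets borel"
  by (simp add: angle_measure_def)

lemma space_angle [simp]: "space angle_measure = UNIV"
  by (simp add: angle_measure_def)

lemma AE_angle_finite:
  assumes "finite ({0..2 * pi} \<inter> {t. \<not> P t})"
  shows "AE t in angle_measure. P t"
proof -
  have "AE t in lborel. t \<notin> {0..2 * pi} \<inter> {t. \<not> P t}"
    using assms by (intro AE_not_in finite_imp_null_set_lborel)
  thus ?thesis unfolding angle_measure_def
    by (intro AE_uniform_measureI) auto
qed

lemma has_bochner_integral_angle_continuous:
  fixes f :: "real \<Rightarrow> real"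
  assumes "continuous_on {0..2 * pi} f" "(f has_integral I) {0..2 * pi}" and [measurable]: "f \<in> borel_measurable borel"
  shows "has_bochner_integral angle_measure f (I / (2 * pi))"
proof -
  have si: "set_integrable lborel {0..2 * pi} f"
    using assms(1) by (intro borel_integrable_atLeastAtMost') 
  have eq: "(LINT t:{0..2 * pi}|lborel. f t) = I"
    using set_borel_integral_eq_integral(2)[OF si] integral_unique[OF assms(2)] by simp
  have dens: "angle_measure = density lborel (\<lambda>t. ennreal (indicator {0..2 * pi} t / (2 * pi)))"
    unfolding angle_measure_def uniform_measure_def
    by (intro density_cong) (auto simp: indicator_def divide_ennreal simp flip: ennreal_1)
  have "has_bochner_integral lborel (\<lambda>t. (indicator {0..2 * pi} t * f t) / (2 * pi)) (I / (2 * pi))"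
    using si eq unfolding set_integrable_def set_lebesgue_integral_def
    by (intro has_bochner_integral_divide) (auto simp: has_bochner_integral_iff)
  hence "has_bochner_integral lborel (\<lambda>t. (indicator {0..2 * pi} t / (2 * pi)) *\<^sub>R f t) (I / (2 * pi))"
    by (simp add: field_simps)
  thus ?thesis
    unfolding dens by (intro has_bochner_integral_density) auto
qed

lemma borel_measurable_cis [measurable]: "cis \<in> borel_measurable borel"
  by (intro borel_measurable_continuous_onI continuous_intros)

lemma AE_circle_ne:
  assumes "s > 0"
  shows "AE t in angle_measure. a + of_real s * cis t \<noteq> 0"
proof (rule AE_angle_finite)
  have inj: "inj_on cis {0..<2 * pi}"
    by (rule inj_onI) (metis Arg2pi_unique atLeastLessThan_iff cis_conv_exp mult_1 of_real_1 zero_less_one)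
  have "{0..2 * pi} \<inter> {t. \<not> (a + of_real s * cis t \<noteq> 0)} \<subseteq>
      insert (2 * pi) (cis -` {- a / of_real s} \<inter> {0..<2 * pi})"
    using assms by (auto simp: field_simps add_eq_0_iff)
  moreover have "finite (cis -` {- a / of_real s} \<inter> {0..<2 * pi})"
    by (rule finite_vimage_IntI[OF _ inj]) auto
  ultimately show "finite ({0..2 * pi} \<inter> {t. \<not> (a + of_real s * cis t \<noteq> 0)})"
    by (meson finite_insert finite_subset)
qed

text \<open>The mean value property at the origin for \<open>ln \<bar>1 + b z\<bar>\<close>, which is harmonic on the closed
unit disc as the real part of \<open>Ln (1 + b z)\<close>; Cauchy's integral formula is the mean value property
of the latter.\<close>

lemma has_bochner_integral_log_norm_lt_1:
  assumes "cmod b < 1"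
  shows "has_bochner_integral angle_measure (\<lambda>t. ln (cmod (1 + b * cis t))) 0"
proof -
  have ne: "1 + b * z \<noteq> 0" "1 + b * z \<notin> \<real>\<^sub>\<le>\<^sub>0" if "cmod z \<le> 1" for z
  proof -
    have "cmod (b * z) < 1" using that assms
      using mult_left_le[of "cmod z" "cmod b"] by (simp add: norm_mult)
    hence "Re (1 + b * z) > 0" using abs_Re_le_cmod[of "b * z"] by simp
    thus "1 + b * z \<notin> \<real>\<^sub>\<le>\<^sub>0" by (auto simp: complex_nonpos_Reals_iff)
    thus "1 + b * z \<noteq> 0" by auto
  qed
  have hol: "(\<lambda>z. Ln (1 + b * z)) holomorphic_on cball 0 1"
    by (intro holomorphic_intros) (use ne in auto)
  have "((\<lambda>u. Ln (1 + b * u) / (u - 0)) has_contour_integral (2 * of_real pi * \<i> * Ln (1 + b * 0)))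
         (circlepath 0 1)"
    by (rule Cauchy_integral_circlepath_simple[OF hol]) auto
  hence "((\<lambda>u. Ln (1 + b * u) / u) has_contour_integral 0) (part_circlepath 0 1 0 (2 * pi))"
    by (simp add: circlepath_def)
  hence "((\<lambda>t. Ln (1 + b * (0 + of_real 1 * cis t)) / (0 + of_real 1 * cis t) * of_real 1 * \<i> * cis t) has_integral 0) {0..2 * pi}"
    by (subst (asm) has_contour_integral_part_circlepath_iff) auto
  hence "((\<lambda>t. Ln (1 + b * cis t) * \<i>) has_integral 0) {0..2 * pi}"
    by (simp add: field_simps)
  hence "((\<lambda>t. Im (Ln (1 + b * cis t) * \<i>)) has_integral Im 0) {0..2 * pi}"
    by (rule has_integral_Im)
  moreover have "Im (Ln (1 + b * cis t) * \<i>) = ln (cmod (1 + b * cis t))" for t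
    using ne(1)[of "cis t"] by simp
  ultimately have I: "((\<lambda>t. ln (cmod (1 + b * cis t))) has_integral 0) {0..2 * pi}"
    by simp
  have "has_bochner_integral angle_measure (\<lambda>t. ln (cmod (1 + b * cis t))) (0 / (2 * pi))"
    by (rule has_bochner_integral_angle_continuous[OF _ I])
       (use ne in \<open>auto intro!: continuous_intros\<close>)
  thus ?thesis by simp
qed

text \<open>The logarithm now has a singularity on the path of integration. The value passes to the
limit from the radii \<open>\<rho> < 1\<close>: the inequality \<open>\<bar>1 + b z\<bar> \<le> 2 \<bar>1 + \<rho> b z\<bar>\<close> on the unit circle bounds
the approximations from below by the limit itself up to \<open>ln 2\<close>. Fatou's lemma shows that the limit
is integrable, and then dominated convergence applies.\<close>

lemma has_bochner_integral_log_norm_eq_1: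
  assumes "cmod b = 1"
  shows "has_bochner_integral angle_measure (\<lambda>t. ln (cmod (1 + b * cis t))) 0"
proof -
  define \<rho> where "\<rho> k = 1 - 1 / (real k + 2)" for k :: nat
  have \<rho>: "0 \<le> \<rho> k" "\<rho> k < 1" for k unfolding \<rho>_def by (auto simp: field_simps)
  have \<rho>_lim: "\<rho> \<longlonglongrightarrow> 1" unfolding \<rho>_def by real_asymp
  let ?f = "\<lambda>k t. ln (cmod (1 + (of_real (\<rho> k) * b) * cis t))"
  let ?g = "\<lambda>t. ln (cmod (1 + b * cis t))"
  have hf: "has_bochner_integral angle_measure (?f k) 0" for k
    by (rule has_bochner_integral_log_norm_lt_1) (use \<rho>[of k] assms in \<open>auto simp: norm_mult\<close>)
  have ne: "AE t in angle_measure. 1 + b * cis t \<noteq> 0"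
    using AE_circle_ne[of 1 "1 / b"]
  proof (rule eventually_mono)
    fix t assume "1 / b + of_real 1 * cis t \<noteq> 0"
    moreover have "1 + b * cis t = b * (1 / b + of_real 1 * cis t)" using assms by (auto simp: field_simps)
    ultimately show "1 + b * cis t \<noteq> 0" using assms by (metis mult_eq_0_iff norm_zero zero_neq_one)
  qed simp
  have lim: "AE t in angle_measure. (\<lambda>k. ?f k t) \<longlonglongrightarrow> ?g t"
    using ne
  proof eventually_elim
    case (elim t)
    have "(\<lambda>k. 1 + (of_real (\<rho> k) * b) * cis t) \<longlonglongrightarrow> 1 + (of_real 1 * b) * cis t"
      by (intro tendsto_intros \<rho>_lim)
    from tendsto_ln[OF tendsto_norm[OF this]] elim show ?case by auto
  qed
  have nb: "cmod (b * cis t) = 1" for t using assms by (simp add: norm_mult)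
  have up: "cmod (1 + (of_real (\<rho> k) * b) * cis t) \<le> 2" for k t
  proof -
    have "cmod (1 + (of_real (\<rho> k) * b) * cis t) \<le> 1 + \<rho> k * cmod (b * cis t)"
      by (rule order.trans[OF norm_triangle_ineq]) (use \<rho>[of k] in \<open>simp add: norm_mult\<close>)
    thus ?thesis using \<rho>[of k] nb[of t] by simp
  qed
  have half: "cmod (1 + b * cis t) \<le> 2 * cmod (1 + (of_real (\<rho> k) * b) * cis t)" for k t
  proof -
    let ?z = "1 + (of_real (\<rho> k) * b) * cis t"
    have "1 - \<rho> k \<le> cmod ?z"
      using norm_triangle_ineq2[of 1 "- ((of_real (\<rho> k) * b) * cis t)"] \<rho>[of k] nb[of t]
      by (simp add: norm_mult)
    moreover have "cmod (1 + b * cis t) \<le> cmod ?z + cmod (of_real (1 - \<rho> k) * (b * cis t))"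
      by (rule order.trans[OF _ norm_triangle_ineq]) (simp add: algebra_simps)
    moreover have "cmod (of_real (1 - \<rho> k) * (b * cis t)) = 1 - \<rho> k"
      using \<rho>[of k] nb[of t] by (simp add: norm_mult del: of_real_diff)
    ultimately show ?thesis by linarith
  qed
  have low: "?f k t \<ge> ?g t - ln 2" if "1 + b * cis t \<noteq> 0" for k t
  proof -
    have "cmod (1 + b * cis t) > 0" using that by simp
    moreover from this half[of t k] have "cmod (1 + (of_real (\<rho> k) * b) * cis t) > 0" by linarith
    ultimately have "?g t \<le> ln (2 * cmod (1 + (of_real (\<rho> k) * b) * cis t))"
      using half[of t k] by simp
    also have "\<dots> = ln 2 + ?f k t"
      using \<open>cmod (1 + (of_real (\<rho> k) * b) * cis t) > 0\<close> by (simp add: ln_mult)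
    finally show ?thesis by linarith
  qed
  have upl: "?f k t \<le> ln 2" for k t
    using up[of k t] by (cases "1 + (of_real (\<rho> k) * b) * cis t = 0") auto
  have gup: "?g t \<le> ln 2" for t
  proof (cases "1 + b * cis t = 0")
    case False
    have "cmod (1 + b * cis t) \<le> 2" using norm_triangle_ineq[of 1 "b * cis t"] nb[of t] by simp
    thus ?thesis using False by auto
  qed auto
  have int: "integrable angle_measure ?g"
  proof -
    have "integrable angle_measure (\<lambda>t. ln 2 - ?g t)"
    proof (rule integrableI_bounded)
      have "(\<integral>\<^sup>+ t. ennreal (norm (ln 2 - ?g t)) \<partial>angle_measure)
          = (\<integral>\<^sup>+ t. liminf (\<lambda>k. ennreal (ln 2 - ?f k t)) \<partial>angle_measure)"
      proof (rule nn_integral_cong_AE)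
        show "AE t in angle_measure. ennreal (norm (ln 2 - ?g t)) = liminf (\<lambda>k. ennreal (ln 2 - ?f k t))"
          using lim
        proof eventually_elim
          case (elim t)
          have "(\<lambda>k. ennreal (ln 2 - ?f k t)) \<longlonglongrightarrow> ennreal (ln 2 - ?g t)"
            by (intro tendsto_ennrealI tendsto_intros elim)
          thus ?case using gup[of t] by (simp add: lim_imp_Liminf)
        qed
      qed
      also have "\<dots> \<le> liminf (\<lambda>k. \<integral>\<^sup>+ t. ennreal (ln 2 - ?f k t) \<partial>angle_measure)"
        by (rule nn_integral_liminf) auto
      also have "(\<lambda>k. \<integral>\<^sup>+ t. ennreal (ln 2 - ?f k t) \<partial>angle_measure) = (\<lambda>k. ennreal (ln 2))"
      proof
        fix k
        have "integrable angle_measure (\<lambda>t. ln 2 - ?f k t)" "(LINT t|angle_measure. ln 2 - ?f k t) = ln 2"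
          using hf[of k] by (auto simp: has_bochner_integral_iff angle.prob_space[simplified])
        thus "(\<integral>\<^sup>+ t. ennreal (ln 2 - ?f k t) \<partial>angle_measure) = ennreal (ln 2)"
          using upl by (subst nn_integral_eq_integral) auto
      qed
      also have "liminf (\<lambda>k::nat. ennreal (ln 2)) < \<infinity>" by (simp add: Liminf_const)
      finally show "(\<integral>\<^sup>+ t. ennreal (norm (ln 2 - ?g t)) \<partial>angle_measure) < \<infinity>" .
    qed auto
    hence "integrable angle_measure (\<lambda>t. ln 2 - (ln 2 - ?g t))" by (rule Bochner_Integration.integrable_diff[rotated]) auto
    thus ?thesis by (simp only: diff_diff_eq2 add_diff_cancel_left')
  qed
  have "(\<lambda>k. integral\<^sup>L angle_measure (?f k)) \<longlonglongrightarrow> integral\<^sup>L angle_measure ?g"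
  proof (rule integral_dominated_convergence[where w = "\<lambda>t. \<bar>?g t\<bar> + ln 2"])
    show "integrable angle_measure (\<lambda>t. \<bar>?g t\<bar> + ln 2)" using int by auto
    show "AE t in angle_measure. norm (?f k t) \<le> \<bar>?g t\<bar> + ln 2" for k
      using ne
    proof eventually_elim
      case (elim t)
      have "ln 2 > (0::real)" by simp
      thus ?case using low[OF elim, of k] upl[of k t] by (simp add: abs_if split: if_splits)
    qed
  qed (use lim in auto)
  moreover have "integral\<^sup>L angle_measure (?f k) = 0" for k
    using hf[of k] by (simp add: has_bochner_integral_iff)
  ultimately have "(\<lambda>k. 0) \<longlonglongrightarrow> integral\<^sup>L angle_measure ?g" by simp
  hence "integral\<^sup>L angle_measure ?g = 0" by (simp add: LIMSEQ_const_iff)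
  thus ?thesis using int by (simp add: has_bochner_integral_iff)
qed

text \<open>Jensen's formula for a linear factor. Dividing by the larger of \<open>\<bar>a\<bar>\<close> and \<open>s\<close> reduces it to
the unit disc; when \<open>s\<close> is the larger one, a rotation and a conjugation exchange the roles of \<open>a\<close>
and \<open>s\<close>.\<close>

lemma has_bochner_integral_log_norm_circle:
  assumes "s > 0"
  shows "has_bochner_integral angle_measure (\<lambda>t. ln (cmod (a + of_real s * cis t))) (ln (max s (cmod a)))"
proof (cases "cmod a \<ge> s")
  case True
  hence a: "a \<noteq> 0" using assms by auto
  let ?b = "of_real s / a"
  have b: "cmod ?b \<le> 1" using True assms by (simp add: norm_divide divide_le_eq)
  have "has_bochner_integral angle_measure (\<lambda>t. ln (cmod (1 + ?b * cis t))) 0"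
    using b has_bochner_integral_log_norm_lt_1[of ?b] has_bochner_integral_log_norm_eq_1[of ?b]
    unfolding le_less by blast
  hence "has_bochner_integral angle_measure (\<lambda>t. ln (cmod a) + ln (cmod (1 + ?b * cis t))) (ln (cmod a) + 0)"
    by (intro has_bochner_integral_add) (auto simp: has_bochner_integral_iff angle.prob_space[simplified])
  moreover have "AE t in angle_measure. ln (cmod a) + ln (cmod (1 + ?b * cis t)) = ln (cmod (a + of_real s * cis t))"
    using AE_circle_ne[OF assms, of a]
  proof eventually_elim
    case (elim t)
    have "a + of_real s * cis t = a * (1 + ?b * cis t)" using a by (simp add: field_simps)
    thus ?case using elim a by (simp add: norm_mult ln_mult)
  qed
  ultimately show ?thesis using True by (subst (asm) has_bochner_integral_cong_AE) (auto simp: max_def)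
next
  case False
  let ?b = "cnj a / of_real s"
  have b: "cmod ?b < 1" using False assms by (simp add: norm_divide divide_less_eq)
  have "has_bochner_integral angle_measure (\<lambda>t. ln s + ln (cmod (1 + ?b * cis t))) (ln s + 0)"
    using has_bochner_integral_log_norm_lt_1[OF b]
    by (intro has_bochner_integral_add) (auto simp: has_bochner_integral_iff angle.prob_space[simplified])
  moreover have "ln s + ln (cmod (1 + ?b * cis t)) = ln (cmod (a + of_real s * cis t))" for t
  proof -
    have "cmod (?b * cis t) = cmod ?b" by (subst norm_mult) simp
    with b have "cmod (?b * cis t) < 1" by simp
    hence ne: "1 + ?b * cis t \<noteq> 0" by (metis add_eq_0_iff less_irrefl norm_minus_cancel norm_one)
    have "cmod (a + of_real s * cis t) = cmod (cis (-t)) * cmod (a + of_real s * cis t)" by simp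
    also have "\<dots> = cmod (a * cis (-t) + of_real s * (cis t * cis (-t)))"
      by (subst norm_mult[symmetric]) (simp only: distrib_left ac_simps)
    also have "\<dots> = cmod (a * cis (-t) + of_real s)" by (simp add: cis_mult)
    also have "\<dots> = cmod (cnj (a * cis (-t) + of_real s))" by (simp only: complex_mod_cnj)
    also have "cnj (a * cis (-t) + of_real s) = of_real s * (1 + ?b * cis t)"
      using assms by (simp add: field_simps cis_cnj)
    finally show ?thesis using assms ne by (simp add: norm_mult ln_mult)
  qed
  ultimately show ?thesis using False by (simp add: max_def)
qed

section \<open>Jensen means of polynomials\<close>

definition log_mean :: "complex poly \<Rightarrow> complex \<Rightarrow> real \<Rightarrow> real" where
  "log_mean p w s = (LINT t|angle_measure. ln (cmod (poly p (w + of_real s * cis t))))"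

text \<open>That the product has almost no zeros on the circle is carried along in the induction,
because \<open>ln (x * y) = ln x + ln y\<close> fails at \<open>0\<close>, where \<open>ln 0 = 0\<close>.\<close>

lemma has_bochner_integral_log_norm_prod:
  assumes "s > 0"
  shows "(AE t in angle_measure. poly (\<Prod>a\<in>#A. [:-a, 1:]) (w + of_real s * cis t) \<noteq> 0) \<and>
    has_bochner_integral angle_measure
      (\<lambda>t. ln (cmod (poly (\<Prod>a\<in>#A. [:-a, 1:]) (w + of_real s * cis t))))
      (\<Sum>a\<in>#A. ln (max s (dist w a)))"
proof (induction A)
  case (add a A)
  let ?q = "\<Prod>a\<in>#A. [:-a, 1:]"
  have m: "poly (\<Prod>a\<in>#add_mset a A. [:-a, 1:]) (w + of_real s * cis t)
      = ((w - a) + of_real s * cis t) * poly ?q (w + of_real s * cis t)" for t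
    by (simp add: algebra_simps)
  have ne: "AE t in angle_measure. (w - a) + of_real s * cis t \<noteq> 0" by (rule AE_circle_ne[OF assms])
  have "has_bochner_integral angle_measure
      (\<lambda>t. ln (cmod ((w - a) + of_real s * cis t)) + ln (cmod (poly ?q (w + of_real s * cis t))))
      (ln (max s (dist w a)) + (\<Sum>a\<in>#A. ln (max s (dist w a))))"
    using add has_bochner_integral_log_norm_circle[OF assms, of "w - a"]
    by (intro has_bochner_integral_add) (auto simp: dist_norm)
  moreover have "AE t in angle_measure. 
      ln (cmod ((w - a) + of_real s * cis t)) + ln (cmod (poly ?q (w + of_real s * cis t)))
      = ln (cmod (poly (\<Prod>a\<in>#add_mset a A. [:-a, 1:]) (w + of_real s * cis t)))"
    using ne add[THEN conjunct1] unfolding m by eventually_elim (simp add: norm_mult ln_mult)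
  moreover have "(\<lambda>t. poly q (w + of_real s * cis t)) \<in> borel_measurable borel" for q
    by (intro borel_measurable_continuous_onI continuous_intros)
  ultimately have "has_bochner_integral angle_measure
      (\<lambda>t. ln (cmod (poly (\<Prod>a\<in>#add_mset a A. [:-a, 1:]) (w + of_real s * cis t))))
      (\<Sum>a\<in>#add_mset a A. ln (max s (dist w a)))"
    by (subst (asm) has_bochner_integral_cong_AE) (auto simp del: prod_mset.insert image_mset_add_mset simp: measurable_cong_sets[OF sets_angle refl])
  thus ?case using ne add[THEN conjunct1] unfolding m by auto
qed (auto simp: has_bochner_integral_zero)

lemma has_bochner_integral_log_norm_poly:
  assumes "p \<noteq> 0" "s > 0"
  shows "has_bochner_integral angle_measure (\<lambda>t. ln (cmod (poly p (w + of_real s * cis t))))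
      (ln (cmod (lead_coeff p)) + (\<Sum>a\<in>#proots p. ln (max s (dist w a))))"
proof -
  let ?q = "\<Prod>a\<in>#proots p. [:-a, 1:]"
  note q = has_bochner_integral_log_norm_prod[OF assms(2), of "proots p" w]
  have p: "poly p z = lead_coeff p * poly ?q z" for z
    by (subst complex_poly_decompose_multiset[symmetric]) (simp only: poly_smult)
  have "has_bochner_integral angle_measure
      (\<lambda>t. ln (cmod (lead_coeff p)) + ln (cmod (poly ?q (w + of_real s * cis t))))
      (ln (cmod (lead_coeff p)) + (\<Sum>a\<in>#proots p. ln (max s (dist w a))))"
    using q by (intro has_bochner_integral_add) (auto simp: has_bochner_integral_iff angle.prob_space[simplified])
  moreover have "AE t in angle_measure. 
      ln (cmod (lead_coeff p)) + ln (cmod (poly ?q (w + of_real s * cis t)))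
      = ln (cmod (poly p (w + of_real s * cis t)))"
    using q[THEN conjunct1] unfolding p by eventually_elim (use assms in \<open>simp add: norm_mult ln_mult\<close>)
  moreover have "(\<lambda>t. poly q (w + of_real s * cis t)) \<in> borel_measurable borel" for q
    by (intro borel_measurable_continuous_onI continuous_intros)
  ultimately show ?thesis
    by (subst (asm) has_bochner_integral_cong_AE) (auto simp: measurable_cong_sets[OF sets_angle refl])
qed

lemma integrable_log_norm_poly:
  assumes "s > 0"
  shows "integrable angle_measure (\<lambda>t. ln (cmod (poly p (w + of_real s * cis t))))"
  using has_bochner_integral_log_norm_poly[OF _ assms, of p w] 
  by (cases "p = 0") (auto simp: has_bochner_integral_iff)

abbreviation zero_count :: "complex poly \<Rightarrow> complex set \<Rightarrow> nat" where
  "zero_count p E \<equiv> size (filter_mset (\<lambda>z. z \<in> E) (proots p))"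

lemma sum_mset_diff_fun:
  fixes f g :: "'b \<Rightarrow> 'c::ab_group_add"
  shows "(\<Sum>a\<in>#A. f a - g a) = (\<Sum>a\<in>#A. f a) - (\<Sum>a\<in>#A. g a)"
  by (induction A) auto

text \<open>Taking differences removes the leading coefficient. It also makes the formula true for \<open>p =
0\<close>, whose logarithmic mean and multiset of zeros are both trivial, so that random polynomials need
no case distinction.\<close>

lemma log_mean_diff:
  assumes "0 < s'" "0 < s"
  shows "log_mean p w s - log_mean p w s' =
    (\<Sum>a\<in>#proots p. ln (max s (dist w a)) - ln (max s' (dist w a)))"
proof (cases "p = 0")
  case False
  thus ?thesis unfolding log_mean_def 
    using has_bochner_integral_log_norm_poly[OF False assms(1), of w]
      has_bochner_integral_log_norm_poly[OF False assms(2), of w]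
    by (simp add: has_bochner_integral_iff sum_mset_diff_fun)
qed (auto simp: log_mean_def)

lemma ln_max_diff_bounds:
  fixes d :: real
  assumes "0 < s'" "s' < s"
  shows "(if d < s' then ln (s / s') else 0) \<le> ln (max s d) - ln (max s' d)"
    and "ln (max s d) - ln (max s' d) \<le> (if d < s then ln (s / s') else 0)"
  using assms by (auto simp: max_def ln_div)

text \<open>A zero at distance \<open>d < s'\<close> from \<open>w\<close> contributes \<open>ln (s / s')\<close> to the difference of the
means, one at distance \<open>d \<ge> s\<close> contributes \<open>0\<close>, and one in between something in between.\<close>

lemma zero_count_log_mean:
  assumes "0 < s'" "s' < s"
  shows "real (zero_count p (ball w s')) * ln (s / s') \<le> log_mean p w s - log_mean p w s'"
    and "log_mean p w s - log_mean p w s' \<le> real (zero_count p (ball w s)) * ln (s / s')"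
proof -
  have s: "s > 0" using assms by simp
  have "real (size (filter_mset (\<lambda>z. z \<in> ball w s') A)) * ln (s / s')
      \<le> (\<Sum>a\<in>#A. ln (max s (dist w a)) - ln (max s' (dist w a)))" for A
  proof (induction A)
    case (add a A)
    thus ?case using ln_max_diff_bounds(1)[OF assms, of "dist w a"] by (auto simp: algebra_simps)
  qed auto
  thus "real (zero_count p (ball w s')) * ln (s / s') \<le> log_mean p w s - log_mean p w s'"
    using log_mean_diff[OF assms(1) s] by simp
  have "(\<Sum>a\<in>#A. ln (max s (dist w a)) - ln (max s' (dist w a)))
      \<le> real (size (filter_mset (\<lambda>z. z \<in> ball w s) A)) * ln (s / s')" for A
  proof (induction A)
    case (add a A)
    thus ?case using ln_max_diff_bounds(2)[OF assms, of "dist w a"] by (auto simp: algebra_simps)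
  qed auto
  thus "log_mean p w s - log_mean p w s' \<le> real (zero_count p (ball w s)) * ln (s / s')"
    using log_mean_diff[OF assms(1) s] by simp
qed

text \<open>Once \<open>s'\<close> exceeds all distances smaller than \<open>s\<close> between \<open>w\<close> and a zero, no zero lies in
between, and the two bounds of \<open>zero_count_log_mean\<close> agree.\<close>

lemma eventually_log_mean_diff_eq_zero_count:
  assumes "s > 0"
  shows "eventually (\<lambda>s'. log_mean p w s - log_mean p w s' = real (zero_count p (ball w s)) * ln (s / s')) (at_left s)"
proof -
  have "eventually (\<lambda>s'. (\<Sum>a\<in>#A. ln (max s (dist w a)) - ln (max s' (dist w a)))
      = real (size (filter_mset (\<lambda>z. z \<in> ball w s) A)) * ln (s / s')) (at_left s)" for A
  proof (induction A)
    case (add a A)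
    have "eventually (\<lambda>s'. ln (max s (dist w a)) - ln (max s' (dist w a)) 
        = (if dist w a < s then ln (s / s') else 0)) (at_left s)"
    proof (cases "dist w a < s")
      case True
      have "eventually (\<lambda>s'. s' \<in> {max (s / 2) (dist w a)<..<s}) (at_left s)"
        using True assms by (intro eventually_at_leftI[of "max (s / 2) (dist w a)"]) auto
      thus ?thesis by eventually_elim (use True assms in \<open>auto simp: max_def ln_div split: if_splits\<close>)
    next
      case False
      have "eventually (\<lambda>s'. s' \<in> {s / 2<..<s}) (at_left s)"
        using assms by (intro eventually_at_leftI[of "s / 2"]) auto
      thus ?thesis by eventually_elim (use False assms in \<open>auto simp: max_def\<close>)
    qed
    from this add.IH show ?case by eventually_elim (auto simp: algebra_simps)
  qed auto
  moreover have "eventually (\<lambda>s'. s' \<in> {s / 2<..<s}) (at_left s)"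
    using assms by (intro eventually_at_leftI[of "s / 2"]) auto
  ultimately show ?thesis
    by eventually_elim (use assms in \<open>auto simp: log_mean_diff\<close>)
qed

section \<open>Measurability of the zero count\<close>

lemma poly_random_poly: "poly (random_poly C n \<omega>) z = (\<Sum>k\<le>n. C k \<omega> * z ^ k)"
  by (simp add: random_poly_def poly_sum poly_monom)

lemma degree_random_poly: "degree (random_poly C n \<omega>) \<le> n"
  unfolding random_poly_def by (intro degree_sum_le) (auto intro: order.trans[OF degree_monom_le])

lemma zero_count_le: "zero_count (random_poly C n \<omega>) E \<le> n"
  using size_proots_le[of "random_poly C n \<omega>"] degree_random_poly[of C n \<omega>]
    size_filter_mset_lesseq[of "\<lambda>z. z \<in> E" "proots (random_poly C n \<omega>)"] by linarith

lemma measurable_log_norm_random_poly: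
  assumes [measurable]: "\<And>k. C k \<in> borel_measurable M"
  shows "(\<lambda>(\<omega>, t). ln (cmod (poly (random_poly C n \<omega>) (w + of_real s * cis t)))) \<in> borel_measurable (M \<Otimes>\<^sub>M angle_measure)"
  unfolding poly_random_poly by measurable

lemma measurable_log_mean_random_poly:
  assumes "\<And>k. C k \<in> borel_measurable M"
  shows "(\<lambda>\<omega>. log_mean (random_poly C n \<omega>) w s) \<in> borel_measurable M"
  unfolding log_mean_def using measurable_log_norm_random_poly[OF assms]
  by (rule angle.borel_measurable_lebesgue_integral)

text \<open>The coefficients enter the means \<open>log_mean\<close> measurably by Fubini's theorem, and the zero
count is a pointwise limit of quotients of their differences as the inner radius tends to \<open>s\<close> from
below.\<close>

lemma measurable_zero_count_random_poly:
  assumes "\<And>k. C k \<in> borel_measurable M"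
  shows "(\<lambda>\<omega>. real (zero_count (random_poly C n \<omega>) (ball w s))) \<in> borel_measurable M"
proof (cases "s > 0")
  case True
  define u where "u j = s * (1 - 1 / (real j + 2))" for j :: nat
  have u: "u j < s" for j using True unfolding u_def by (simp add: field_simps)
  have up: "u j > 0" for j using True unfolding u_def by (intro mult_pos_pos) (auto simp: field_simps)
  have "u \<longlonglongrightarrow> s" unfolding u_def by real_asymp
  hence ul: "filterlim u (at_left s) sequentially"
    using u by (auto simp: filterlim_at intro!: always_eventually)
  let ?q = "\<lambda>j \<omega>. (log_mean (random_poly C n \<omega>) w s - log_mean (random_poly C n \<omega>) w (u j)) / ln (s / u j)"
  show ?thesis
  proof (rule borel_measurable_LIMSEQ_real)
    show "?q j \<in> borel_measurable M" for j
      using measurable_log_mean_random_poly[OF assms] by measurable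
    fix \<omega>
    have "eventually (\<lambda>j. real (zero_count (random_poly C n \<omega>) (ball w s)) = ?q j \<omega>) sequentially"
      using eventually_compose_filterlim[OF eventually_log_mean_diff_eq_zero_count[OF True] ul]
    proof (rule eventually_mono)
      fix j assume *: "log_mean (random_poly C n \<omega>) w s - log_mean (random_poly C n \<omega>) w (u j)
        = real (zero_count (random_poly C n \<omega>) (ball w s)) * ln (s / u j)"
      have "ln (s / u j) \<noteq> 0" using u[of j] up[of j] True by (simp add: ln_div)
      thus "real (zero_count (random_poly C n \<omega>) (ball w s)) = ?q j \<omega>" unfolding * by simp
    qed
    thus "(\<lambda>j. ?q j \<omega>) \<longlonglongrightarrow> real (zero_count (random_poly C n \<omega>) (ball w s))"
      by (rule Lim_transform_eventually[OF tendsto_const])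
  qed
qed (simp add: ball_empty)

section \<open>The potential of the uniform measure on the unit circle\<close>

text \<open>The share of the unit circle lying in a disc of radius \<open>s\<close> around one of its points
(\<open>prob_arc\<close>).\<close>

definition arc_share :: "real \<Rightarrow> real" where
  "arc_share s = 2 * arcsin (s / 2) / pi"

lemma norm_one_minus_cis:
  assumes "0 \<le> t" "t \<le> 2 * pi"
  shows "cmod (1 - cis t) = 2 * sin (t / 2)"
proof -
  \<comment> \<open>Half-angle identity: \<open>\<bar>1 - e^(it)\<bar>^2 = 2 - 2 cos t = 4 sin^2 (t/2)\<close>.\<close>
  have c: "cos t = 1 - 2 * sin (t / 2) ^ 2" using cos_double_sin[of "t / 2"] by simp
  have "cmod (1 - cis t) ^ 2 = (1 - cos t) ^ 2 + sin t ^ 2" by (simp add: cmod_power2)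
  also have "\<dots> = 2 - 2 * cos t" using sin_cos_squared_add[of t] by (simp add: power2_eq_square algebra_simps)
  also have "\<dots> = (2 * sin (t / 2)) ^ 2" unfolding c by (simp add: power2_eq_square)
  finally show ?thesis
    using assms by (intro power2_eq_imp_eq[where x = "cmod (1 - cis t)"]) (auto intro!: sin_ge_zero)
qed

lemma prob_arc:
  assumes "0 < s" "s < 2"
  shows "angle.prob {t. cmod (1 - cis t) < s} = arc_share s"
proof -
  define a where "a = arcsin (s / 2)"
  have a: "0 < a" "a < pi / 2" "sin a = s / 2"
    using assms arcsin_lt_bounded[of "s/2"] arcsin_less_arcsin[of 0 "s / 2"] by (auto simp: a_def)
  have iff: "cmod (1 - cis t) < s \<longleftrightarrow> t < 2 * a \<or> 2 * pi - 2 * a < t" if t: "0 \<le> t" "t \<le> 2 * pi" for t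
  proof -
    have "cmod (1 - cis t) < s \<longleftrightarrow> sin (t / 2) < sin a" unfolding norm_one_minus_cis[OF t] a(3) by linarith
    also have "\<dots> \<longleftrightarrow> t < 2 * a \<or> 2 * pi - 2 * a < t"
    proof (cases "t \<le> pi")
      case True
      thus ?thesis using sin_mono_less_eq[of "t / 2" a] a t by auto
    next
      case False
      have "sin (t / 2) = sin (pi - t / 2)" by simp
      also have "\<dots> < sin a \<longleftrightarrow> pi - t / 2 < a"
        using False t a by (intro sin_mono_less_eq) auto
      finally show ?thesis using False a t by auto
    qed
    finally show ?thesis .
  qed
  have eq: "{0..2 * pi} \<inter> {t. cmod (1 - cis t) < s} = {0..<2 * a} \<union> {2 * pi - 2 * a<..2 * pi}"
  proof (rule set_eqI)
    fix t show "t \<in> {0..2 * pi} \<inter> {t. cmod (1 - cis t) < s} \<longleftrightarrow> t \<in> {0..<2 * a} \<union> {2 * pi - 2 * a<..2 * pi}"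
      using iff[of t] a(1,2) by (cases "0 \<le> t \<and> t \<le> 2 * pi") auto
  qed
  have "angle.prob {t. cmod (1 - cis t) < s} = measure lborel ({0..2 * pi} \<inter> {t. cmod (1 - cis t) < s}) / (2 * pi)"
    unfolding angle_measure_def by (subst measure_uniform_measure) (auto)
  also have "measure lborel ({0..2 * pi} \<inter> {t. cmod (1 - cis t) < s}) = 4 * a"
    unfolding eq using a by (subst measure_Union) auto
  finally show ?thesis unfolding arc_share_def a_def by (simp add: field_simps)
qed

definition log_plus_mean :: "complex \<Rightarrow> real \<Rightarrow> real" where
  "log_plus_mean w s = (LINT t|angle_measure. ln (max 1 (cmod (w + of_real s * cis t))))"

text \<open>Jensen's formula shows that \<open>ln max(1, \<bar>z\<bar>)\<close> is the mean of \<open>ln \<bar>z - x\<bar>\<close> over \<open>x\<close> on the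
unit circle. Averaging over \<open>z\<close> on the circle about \<open>w\<close> and exchanging the two integrals gives the
mean of \<open>ln max(s, \<bar>w - x\<bar>)\<close>, where \<open>x = w e^(iu)\<close> has distance \<open>\<bar>1 - e^(iu)\<bar>\<close> from \<open>w\<close>.\<close>

lemma log_plus_mean_eq:
  assumes w: "cmod w = 1" and "s > 0"
  shows "log_plus_mean w s = (LINT t|angle_measure. ln (max s (cmod (1 - cis t))))"
proof -
  interpret P: pair_prob_space angle_measure angle_measure ..
  define K where "K t u = ln (cmod (w * (1 - cis u) + of_real s * cis t))" for t u
  have Kt: "has_bochner_integral angle_measure (\<lambda>t. K t u) (ln (max s (cmod (1 - cis u))))" for u
    using has_bochner_integral_log_norm_circle[OF assms(2), of "w * (1 - cis u)"] w
    by (simp add: K_def norm_mult)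
  have Ku: "has_bochner_integral angle_measure (K t) (ln (max 1 (cmod (w + of_real s * cis t))))" for t
  proof -
    let ?a = "- (w + of_real s * cis t) / w"
    have "w \<noteq> 0" using w by auto
    hence "w * (1 - cis u) + of_real s * cis t = - w * (?a + of_real 1 * cis u)" for u
      by (simp add: field_simps)
    hence "K t u = ln (cmod (?a + of_real 1 * cis u))" for u
      unfolding K_def using w by (simp only: norm_mult norm_minus_cancel mult_1)
    hence "K t = (\<lambda>u. ln (cmod (?a + of_real 1 * cis u)))" by blast
    moreover have "cmod ?a = cmod (w + of_real s * cis t)" using w by (simp only: norm_divide norm_minus_cancel div_by_1)
    ultimately show ?thesis using has_bochner_integral_log_norm_circle[of 1 ?a] by (simp only: zero_less_one)
  qed
  have Kle: "K t u \<le> ln (2 + s)" for t u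
  proof (cases "w * (1 - cis u) + of_real s * cis t = 0")
    case False
    have "cmod (w * (1 - cis u) + of_real s * cis t) \<le> cmod (1 - cis u) + s"
      using norm_triangle_ineq[of "w * (1 - cis u)" "of_real s * cis t"] w assms(2) by (simp add: norm_mult)
    also have "cmod (1 - cis u) \<le> 2" using norm_triangle_ineq4[of 1 "cis u"] by simp
    finally have "cmod (w * (1 - cis u) + of_real s * cis t) \<le> 2 + s" by simp
    thus ?thesis using False assms(2) unfolding K_def by (intro ln_mono) auto
  qed (use assms in \<open>auto simp: K_def\<close>)
  \<comment> \<open>The kernel is bounded above but not below; this gives absolute integrability from the known mean of \<open>K\<close>.\<close>
  have Kabs: "\<bar>K t u\<bar> \<le> 2 * ln (2 + s) - K t u" for t u
    using Kle[of t u] ln_ge_zero[of "2 + s"] assms by linarith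
  have [measurable]: "(\<lambda>(t, u). K t u) \<in> borel_measurable (angle_measure \<Otimes>\<^sub>M angle_measure)"
    unfolding K_def by measurable
  have "integrable (angle_measure \<Otimes>\<^sub>M angle_measure) (\<lambda>(t, u). K t u)"
  proof (rule P.Fubini_integrable)
    show "AE t in angle_measure. integrable angle_measure (\<lambda>u. case (t, u) of (t, u) \<Rightarrow> K t u)"
      using Ku by (auto simp: has_bochner_integral_iff)
    have "norm (LINT u|angle_measure. \<bar>K t u\<bar>) \<le> 2 * ln (2 + s)" for t
    proof -
      have "(LINT u|angle_measure. \<bar>K t u\<bar>) \<le> (LINT u|angle_measure. 2 * ln (2 + s) - K t u)"
        using Ku[of t] Kabs by (intro integral_mono) (auto simp: has_bochner_integral_iff)
      also have "\<dots> = 2 * ln (2 + s) - ln (max 1 (cmod (w + of_real s * cis t)))"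
        using Ku[of t] by (simp add: has_bochner_integral_iff angle.prob_space[simplified])
      also have "\<dots> \<le> 2 * ln (2 + s)" by simp
      finally show ?thesis by simp
    qed
    moreover have "(\<lambda>t. LINT u|angle_measure. \<bar>K t u\<bar>) \<in> borel_measurable angle_measure"
      by (rule angle.borel_measurable_lebesgue_integral) simp
    ultimately show "integrable angle_measure (\<lambda>t. LINT u|angle_measure. norm (case (t, u) of (t, u) \<Rightarrow> K t u))"
      by (intro angle.integrable_const_bound[where B = "2 * ln (2 + s)"]) auto
  qed simp
  hence "(LINT u|angle_measure. LINT t|angle_measure. K t u) = (LINT t|angle_measure. LINT u|angle_measure. K t u)"
    by (rule P.Fubini_integral)
  thus ?thesis using Kt Ku by (simp add: log_plus_mean_def has_bochner_integral_iff)
qed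

text \<open>The analogue of \<open>zero_count_log_mean\<close> for the uniform measure: the points of the unit
circle play the part of the zeros.\<close>

lemma log_plus_mean_diff:
  assumes w: "cmod w = 1" and s: "0 < s'" "s' < s" "s < 2"
  shows "arc_share s' * ln (s / s') \<le> log_plus_mean w s - log_plus_mean w s'"
    and "log_plus_mean w s - log_plus_mean w s' \<le> arc_share s * ln (s / s')"
proof -
  let ?d = "\<lambda>t. cmod (1 - cis t)"
  have d2: "?d t \<le> 2" for t using norm_triangle_ineq4[of 1 "cis t"] by simp
  have int: "integrable angle_measure (\<lambda>t. ln (max x (?d t)))" if "x > 0" for x
  proof (rule angle.integrable_const_bound[where B = "\<bar>ln x\<bar> + ln (max x 2)"])
    have "\<bar>ln (max x (?d t))\<bar> \<le> \<bar>ln x\<bar> + ln (max x 2)" for t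
    proof -
      have "ln x \<le> ln (max x (?d t))" using that by simp
      moreover have "ln (max x (?d t)) \<le> ln (max x 2)" using d2[of t] that by (subst ln_le_cancel_iff) auto
      moreover have "ln (max x 2) \<ge> 0" by simp
      ultimately show ?thesis by linarith
    qed
    thus "AE t in angle_measure. norm (ln (max x (?d t))) \<le> \<bar>ln x\<bar> + ln (max x 2)" by simp
  qed measurable
  have eq: "log_plus_mean w s - log_plus_mean w s' = (LINT t|angle_measure. ln (max s (?d t)) - ln (max s' (?d t)))"
    using int s by (simp add: log_plus_mean_eq[OF w])
  have ii: "integrable angle_measure (\<lambda>t. indicator {t. ?d t < x} t * c)" for x c :: real
    by (rule angle.integrable_const_bound[where B = "\<bar>c\<bar>"]) (auto simp: indicator_def)
  have ind: "(LINT t|angle_measure. indicator {t. ?d t < x} t * c) = angle.prob {t. ?d t < x} * c" for x c :: real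
    by (subst integral_mult_left_zero) (simp only: Bochner_Integration.integral_indicator space_angle Int_UNIV_right)
  have "arc_share s' * ln (s / s') = (LINT t|angle_measure. indicator {t. ?d t < s'} t * ln (s / s'))"
    using prob_arc[of s'] s by (simp add: ind)
  also have "\<dots> \<le> log_plus_mean w s - log_plus_mean w s'" unfolding eq
  proof (rule integral_mono)
    show "indicator {t. ?d t < s'} t * ln (s / s') \<le> ln (max s (?d t)) - ln (max s' (?d t))" for t
      using ln_max_diff_bounds(1)[OF s(1,2), of "?d t"] by (auto simp: indicator_def split: if_splits)
  qed (use int s ii in auto)
  finally show "arc_share s' * ln (s / s') \<le> log_plus_mean w s - log_plus_mean w s'" .
  have "log_plus_mean w s - log_plus_mean w s' \<le> (LINT t|angle_measure. indicator {t. ?d t < s} t * ln (s / s'))" unfolding eq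
  proof (rule integral_mono)
    show "ln (max s (?d t)) - ln (max s' (?d t)) \<le> indicator {t. ?d t < s} t * ln (s / s')" for t
      using ln_max_diff_bounds(2)[OF s(1,2), of "?d t"] by (auto simp: indicator_def split: if_splits)
  qed (use int s ii in auto)
  also have "\<dots> = arc_share s * ln (s / s')"
    using prob_arc[of s] s by (simp add: ind)
  finally show "log_plus_mean w s - log_plus_mean w s' \<le> arc_share s * ln (s / s')" .
qed

lemma arc_share_lipschitz:
  assumes "0 < r" "r < 2"
  obtains c where "eventually (\<lambda>h. arc_share (r + h) \<le> arc_share r + c * h \<and> arc_share r - c * h \<le> arc_share (r - h)) (at_right 0)"
proof -
  have "(arc_share has_real_derivative (inverse (sqrt (1 - (r / 2)\<^sup>2)) / pi)) (at r)"
    unfolding arc_share_def using assms by (auto intro!: derivative_eq_intros)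
  then obtain D where D: "(arc_share has_real_derivative D) (at r)" by blast
  hence "((\<lambda>h. (arc_share (r + h) - arc_share r) / h) \<longlongrightarrow> D) (at 0)" by (simp add: DERIV_def)
  hence ev: "eventually (\<lambda>h. (arc_share (r + h) - arc_share r) / h < D + 1) (at 0)"
    by (rule order_tendstoD) simp
  hence ev1: "eventually (\<lambda>h. (arc_share (r + h) - arc_share r) / h < D + 1) (at_right 0)"
    by (simp add: eventually_at_split)
  from ev have "eventually (\<lambda>h. (arc_share (r + h) - arc_share r) / h < D + 1) (at_left 0)"
    by (simp add: eventually_at_split)
  hence ev2: "eventually (\<lambda>h. (arc_share (r - h) - arc_share r) / (- h) < D + 1) (at_right 0)"
    by (subst (asm) at_left_minus) (simp add: eventually_filtermap)
  have "eventually (\<lambda>h. arc_share (r + h) \<le> arc_share r + (D + 1) * h \<and> arc_share r - (D + 1) * h \<le> arc_share (r - h)) (at_right 0)"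
    using ev1 ev2 eventually_at_right_less[of 0]
    by eventually_elim (auto simp: field_simps)
  thus ?thesis by (rule that)
qed

section \<open>Anti-concentration of random sums\<close>

text \<open>The negative part of the logarithm. The value \<open>\<infinity>\<close> at \<open>0\<close>, in contrast to \<open>ln 0 = 0\<close>, makes
a bound on the integral of \<open>neg_log\<close> control the places where a polynomial vanishes.\<close>

definition neg_log :: "real \<Rightarrow> ennreal" where
  "neg_log x = (if x = 0 then \<infinity> else ennreal (- ln x))"

lemma borel_measurable_neg_log [measurable]: "neg_log \<in> borel_measurable borel"
  unfolding neg_log_def by measurable

lemma neg_log_mult_le:
  assumes "0 < a" "a \<le> 1" "0 \<le> b"
  shows "neg_log (a * b) \<le> ennreal (- ln a) + neg_log b"
proof (cases "b = 0")
  case False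
  have "ln (a * b) = ln a + ln b" using assms False by (simp add: ln_mult)
  moreover have "ennreal (- ln a - ln b) \<le> ennreal (- ln a) + ennreal (- ln b)"
    using assms
    by (cases "ln b \<le> 0") (auto simp: ennreal_neg ennreal_leI simp flip: ennreal_plus)
  ultimately show ?thesis using assms False by (simp add: neg_log_def)
qed (auto simp: neg_log_def)

text \<open>Layer-cake bound: \<open>x < exp (- j)\<close> holds for the \<open>j < - ln x\<close>, and there are at least \<open>- ln
x\<close> of them. It turns bounds on the measures of small discs into a bound on a logarithmic
integral.\<close>

lemma neg_log_le_suminf:
  assumes "0 \<le> x"
  shows "neg_log x \<le> (\<Sum>j. indicator {..<exp (- real j)} x)"
proof -
  have le: "of_nat m \<le> (\<Sum>j. indicator {..<exp (- real j)} x :: ennreal)"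
    if "\<And>j. j < m \<Longrightarrow> x < exp (- real j)" for m
  proof -
    have "of_nat m = (\<Sum>j<m. indicator {..<exp (- real j)} x :: ennreal)" using that by simp
    also have "\<dots> \<le> (\<Sum>j. indicator {..<exp (- real j)} x)" by (rule sum_le_suminf) auto
    finally show ?thesis .
  qed
  show ?thesis
  proof (cases "x = 0")
    case True
    have "(\<Sum>j. indicator {..<exp (- real j)} x :: ennreal) = \<infinity>"
    proof (rule ccontr)
      assume "(\<Sum>j. indicator {..<exp (- real j)} x :: ennreal) \<noteq> \<infinity>"
      then obtain m where "(\<Sum>j. indicator {..<exp (- real j)} x :: ennreal) < of_nat m"
        using ennreal_Ex_less_of_nat[of "\<Sum>j. indicator {..<exp (- real j)} x"] by (auto simp: less_top)
      thus False using le[of m] True by auto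
    qed
    thus ?thesis by simp
  next
    case False
    define m where "m = nat \<lceil>- ln x\<rceil>"
    have "x < exp (- real j)" if "j < m" for j
    proof -
      have "real j < - ln x" using that unfolding m_def by linarith
      thus ?thesis using assms False by (metis exp_less_mono exp_ln less_minus_iff order_less_le)
    qed
    from le[OF this] have "of_nat m \<le> (\<Sum>j. indicator {..<exp (- real j)} x :: ennreal)" by blast
    moreover have "neg_log x \<le> of_nat m"
      using False unfolding neg_log_def m_def ennreal_of_nat_eq_real_of_nat
      by (auto intro!: ennreal_leI real_nat_ceiling_ge)
    ultimately show ?thesis by (rule order.trans[rotated])
  qed
qed

text \<open>The sum over \<open>j\<close> of \<open>K\<close> times the area of a disc of radius \<open>exp (- j)\<close>.\<close>

definition log_const :: "real \<Rightarrow> real" where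
  "log_const K = K * pi / (1 - exp (- 2))"

lemma log_const_nonneg: "0 \<le> K \<Longrightarrow> 0 \<le> log_const K"
  by (auto simp: log_const_def)

text \<open>Uniformly in \<open>b\<close>, a measure whose restriction to \<open>A\<close> has a density at most \<open>K\<close> does not
charge small discs around \<open>- b\<close> enough for the logarithm to diverge.\<close>

lemma nn_integral_neg_log_le:
  fixes N :: "complex measure"
  assumes sets [measurable_cong]: "sets N = sets borel" and [measurable]: "A \<in> sets borel" and "0 \<le> K"
    and K: "\<And>B. B \<in> sets borel \<Longrightarrow> emeasure N (A \<inter> B) \<le> ennreal K * emeasure lborel B"
  shows "(\<integral>\<^sup>+x. indicator A x * neg_log (cmod (x + b)) \<partial>N) \<le> ennreal (log_const K)"
proof -
  have "(\<integral>\<^sup>+x. indicator A x * neg_log (cmod (x + b)) \<partial>N)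
      \<le> (\<integral>\<^sup>+x. (\<Sum>j. indicator (A \<inter> ball (- b) (exp (- real j))) x) \<partial>N)"
  proof (rule nn_integral_mono)
    fix x
    have eq: "cmod (x + b) < e \<longleftrightarrow> x \<in> ball (- b) e" for e
      using norm_minus_cancel[of "x + b"] by (simp add: dist_norm algebra_simps)
    have "neg_log (cmod (x + b)) \<le> (\<Sum>j. indicator (ball (- b) (exp (- real j))) x)"
      using neg_log_le_suminf[of "cmod (x + b)"] by (simp add: eq indicator_def)
    thus "indicator A x * neg_log (cmod (x + b)) \<le> (\<Sum>j. indicator (A \<inter> ball (- b) (exp (- real j))) x)"
      by (cases "x \<in> A") (auto simp: indicator_def)
  qed
  also have "\<dots> = (\<Sum>j. emeasure N (A \<inter> ball (- b) (exp (- real j))))"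
    using assms(2) by (subst nn_integral_suminf) (auto simp: sets intro!: borel_measurable_indicator)
  also have "\<dots> \<le> (\<Sum>j. ennreal (K * pi * exp (- 2) ^ j))"
  proof (rule suminf_le)
    fix j
    have "emeasure N (A \<inter> ball (- b) (exp (- real j))) \<le> ennreal K * emeasure lborel (ball (- b) (exp (- real j)))"
      by (rule K) auto
    also have "emeasure lborel (ball (- b) (exp (- real j))) = ennreal (pi * (exp (- real j)) ^ 2)"
      by (subst emeasure_ball) (auto simp: unit_ball_vol_2[simplified])
    also have "(exp (- real j)) ^ 2 = exp (- 2 :: real) ^ j"
      by (simp add: exp_of_nat_mult[symmetric] exp_double[symmetric] mult.commute)
    finally show "emeasure N (A \<inter> ball (- b) (exp (- real j))) \<le> ennreal (K * pi * exp (- 2) ^ j)"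
      using assms(3) by (simp add: ennreal_mult[symmetric] mult.assoc)
  qed auto
  also have "\<dots> = ennreal (\<Sum>j. K * pi * exp (- 2) ^ j)"
    using assms(3) by (intro suminf_ennreal2) (auto intro!: summable_mult summable_geometric)
  also have "(\<Sum>j. K * pi * exp (- 2 :: real) ^ j) = log_const K"
    by (subst suminf_mult) (auto simp: suminf_geometric log_const_def intro!: summable_geometric)
  finally show ?thesis .
qed

text \<open>Fubini's theorem: the joint distribution of one member of an independent family and of the
tuple of the others is a product, so the others may be held fixed while integrating over the one.\<close>

lemma (in prob_space) nn_integral_indep_split:
  fixes X :: "'i \<Rightarrow> 'a \<Rightarrow> 'b::topological_space"
  assumes "indep_vars (\<lambda>_. borel) X I" "k \<in> I"
    and [measurable]: "(\<lambda>(x, v). G x v) \<in> borel_measurable (borel \<Otimes>\<^sub>M (\<Pi>\<^sub>M i\<in>I - {k}. borel))"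
  shows "(\<integral>\<^sup>+\<omega>. G (X k \<omega>) (restrict (\<lambda>i. X i \<omega>) (I - {k})) \<partial>M)
    = (\<integral>\<^sup>+\<omega>. (\<integral>\<^sup>+x. G x (restrict (\<lambda>i. X i \<omega>) (I - {k})) \<partial>distr M borel (X k)) \<partial>M)"
proof -
  let ?P = "\<Pi>\<^sub>M i\<in>I - {k}. (borel :: 'b measure)"
  let ?S = "\<Pi>\<^sub>M i\<in>{k}. (borel :: 'b measure)"
  let ?X = "\<lambda>\<omega>. restrict (\<lambda>i. X i \<omega>) {k}"
  let ?Y = "\<lambda>\<omega>. restrict (\<lambda>i. X i \<omega>) (I - {k})"
  have "indep_var ?S ?X ?P ?Y"
    using assms(2) by (intro indep_var_restrict[OF assms(1)]) auto
  hence eq: "distr M ?S ?X \<Otimes>\<^sub>M distr M ?P ?Y = distr M (?S \<Otimes>\<^sub>M ?P) (\<lambda>\<omega>. (?X \<omega>, ?Y \<omega>))"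
    and [measurable]: "random_variable ?S ?X" "random_variable ?P ?Y"
    by (auto simp: indep_var_distribution_eq)
  have [measurable]: "random_variable borel (X k)" using assms(1,2) by (auto simp: indep_vars_def)
  interpret D: prob_space "distr M ?S ?X" by (rule prob_space_distr) simp
  interpret E: prob_space "distr M ?P ?Y" by (rule prob_space_distr) simp
  interpret DE: pair_prob_space "distr M ?S ?X" "distr M ?P ?Y" ..
  have "(\<integral>\<^sup>+\<omega>. G (X k \<omega>) (?Y \<omega>) \<partial>M)
      = (\<integral>\<^sup>+z. (case z of (u, v) \<Rightarrow> G (u k) v) \<partial>(distr M ?S ?X \<Otimes>\<^sub>M distr M ?P ?Y))"
    unfolding eq by (subst nn_integral_distr) auto
  also have "\<dots> = (\<integral>\<^sup>+v. (\<integral>\<^sup>+u. G (u k) v \<partial>distr M ?S ?X) \<partial>distr M ?P ?Y)"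
    by (subst DE.nn_integral_snd[symmetric]) (auto cong: measurable_cong_sets sets_pair_measure_cong)
  also have "\<dots> = (\<integral>\<^sup>+v. (\<integral>\<^sup>+x. G x v \<partial>distr M borel (X k)) \<partial>distr M ?P ?Y)"
  proof (rule nn_integral_cong)
    fix v assume "v \<in> space (distr M ?P ?Y)"
    hence [measurable]: "(\<lambda>x. G x v) \<in> borel_measurable borel"
      using measurable_Pair_compose_split[OF assms(3), of "\<lambda>x. x" borel "\<lambda>_. v"] by simp
    show "(\<integral>\<^sup>+u. G (u k) v \<partial>distr M ?S ?X) = (\<integral>\<^sup>+x. G x v \<partial>distr M borel (X k))"
      by (simp add: nn_integral_distr)
  qed
  also have "\<dots> = (\<integral>\<^sup>+\<omega>. (\<integral>\<^sup>+x. G x (?Y \<omega>) \<partial>distr M borel (X k)) \<partial>M)"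
  proof (subst nn_integral_distr)
    interpret F: prob_space "distr M borel (X k)" by (rule prob_space_distr) simp
    show "(\<lambda>v. \<integral>\<^sup>+x. G x v \<partial>distr M borel (X k)) \<in> borel_measurable (distr M ?P ?Y)"
      by (rule F.borel_measurable_nn_integral) (use measurable_pair_swap[OF assms(3)] in \<open>auto cong: measurable_cong_sets sets_pair_measure_cong\<close>)
  qed auto
  finally show ?thesis .
qed

lemma sum_geometric_deriv_le:
  fixes q a J :: real
  assumes "0 \<le> q" "q < 1" "0 \<le> a" "0 \<le> J"
  shows "(\<Sum>k\<le>n. q ^ k * (real k * a + J)) \<le> (a + J) / (1 - q) ^ 2"
proof -
  have s: "(\<lambda>k. real (Suc k) * q ^ k) sums (1 / (1 - q) ^ 2)"
    using geometric_deriv_sums[of q] assms by simp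
  have "(\<Sum>k\<le>n. q ^ k * (real k * a + J)) \<le> (\<Sum>k\<le>n. (a + J) * (real (Suc k) * q ^ k))"
  proof (rule sum_mono)
    fix k
    have "real k * a + J \<le> real (Suc k) * (a + J)" using assms by (simp add: algebra_simps)
    from mult_left_mono[OF this, of "q ^ k"] show "q ^ k * (real k * a + J) \<le> (a + J) * (real (Suc k) * q ^ k)"
      using assms by (simp add: mult_ac)
  qed
  also have "\<dots> = (a + J) * (\<Sum>k\<le>n. real (Suc k) * q ^ k)" by (simp only: sum_distrib_left)
  also have "(\<Sum>k\<le>n. real (Suc k) * q ^ k) \<le> 1 / (1 - q) ^ 2"
    using sum_le_suminf[OF sums_summable[OF s], of "{..n}"] sums_unique[OF s] assms by simp
  finally show ?thesis using assms by (simp add: mult_left_mono)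
qed

text \<open>The event is split according to the first index \<open>k\<close> with \<open>X k \<in> A\<close>. Given all other
variables, the sum is \<open>y ^ k * (X k + b)\<close> with \<open>b\<close> fixed, so \<open>nn_integral_neg_log_le\<close> bounds the
integral over \<open>X k\<close> by \<open>k * (- ln \<bar>y\<bar>) + log_const K\<close>. The event that \<open>k\<close> is the first index
depends, apart from \<open>X k \<in> A\<close>, only on the earlier variables and has probability at most \<open>q ^ k\<close>,
which makes the sum over \<open>k\<close> bounded in \<open>n\<close>.\<close>

lemma (in prob_space) neg_log_random_sum_bound:
  fixes X :: "nat \<Rightarrow> 'a \<Rightarrow> complex"
  assumes ind: "indep_vars (\<lambda>_. borel) X {..n}"
    and A [measurable]: "A \<in> sets borel" and K0: "0 \<le> K"
    and K: "\<And>k B. k \<le> n \<Longrightarrow> B \<in> sets borel \<Longrightarrow>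
        emeasure (distr M borel (X k)) (A \<inter> B) \<le> ennreal K * emeasure lborel B"
    and q: "\<And>k. k \<le> n \<Longrightarrow> emeasure (distr M borel (X k)) (- A) \<le> ennreal q" "0 \<le> q" "q < 1"
    and y: "y \<noteq> 0" "cmod y \<le> 1"
  shows "(\<integral>\<^sup>+\<omega>. indicator {\<omega>. \<exists>k\<le>n. X k \<omega> \<in> A} \<omega> * neg_log (cmod (\<Sum>j\<le>n. X j \<omega> * y ^ j)) \<partial>M)
    \<le> ennreal ((log_const K - ln (cmod y)) / (1 - q) ^ 2)"
proof -
  define a where "a = - ln (cmod y)"
  have a0: "0 \<le> a" using y by (simp add: a_def)
  let ?J = "log_const K"
  note J0 = log_const_nonneg[OF K0]
  have rv [measurable]: "random_variable borel (X k)" if "k \<le> n" for k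
    using ind that by (auto simp: indep_vars_def)
  define F where "F k \<omega> = (\<Prod>j<k. indicator (- A) (X j \<omega>)) * (indicator A (X k \<omega>) *
      neg_log (cmod (\<Sum>j\<le>n. X j \<omega> * y ^ j)))" for k \<omega>
  have F_meas [measurable]: "F k \<in> borel_measurable M" if "k \<le> n" for k
  proof -
    have "random_variable borel (X k)" using that by simp
    moreover have "random_variable borel (\<lambda>\<omega>. \<Prod>j<k. indicator (- A) (X j \<omega>) :: ennreal)"
      using that by (intro borel_measurable_prod_ennreal borel_measurable_indicator') auto
    ultimately show ?thesis unfolding F_def by measurable
  qed
  have "(\<integral>\<^sup>+\<omega>. indicator {\<omega>. \<exists>k\<le>n. X k \<omega> \<in> A} \<omega> * neg_log (cmod (\<Sum>j\<le>n. X j \<omega> * y ^ j)) \<partial>M)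
     \<le> (\<integral>\<^sup>+\<omega>. (\<Sum>k\<le>n. F k \<omega>) \<partial>M)"
  proof (rule nn_integral_mono)
    fix \<omega>
    show "indicator {\<omega>. \<exists>k\<le>n. X k \<omega> \<in> A} \<omega> * neg_log (cmod (\<Sum>j\<le>n. X j \<omega> * y ^ j)) \<le> (\<Sum>k\<le>n. F k \<omega>)"
    proof (cases "\<exists>k\<le>n. X k \<omega> \<in> A")
      case True
      define k where "k = (LEAST k. X k \<omega> \<in> A)"
      have k: "X k \<omega> \<in> A" "k \<le> n" "\<And>j. j < k \<Longrightarrow> X j \<omega> \<notin> A"
        using True unfolding k_def by (auto intro: LeastI Least_le order.trans dest: not_less_Least)
      have "neg_log (cmod (\<Sum>j\<le>n. X j \<omega> * y ^ j)) = F k \<omega>" using k by (simp add: F_def)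
      also have "\<dots> \<le> (\<Sum>k\<le>n. F k \<omega>)" using k(2) by (intro member_le_sum) auto
      finally show ?thesis using True by simp
    qed simp
  qed
  also have "\<dots> = (\<Sum>k\<le>n. \<integral>\<^sup>+\<omega>. F k \<omega> \<partial>M)" by (rule nn_integral_sum) auto
  also have "\<dots> \<le> (\<Sum>k\<le>n. ennreal (q ^ k * (real k * a + ?J)))"
  proof (rule sum_mono)
    fix k assume "k \<in> {..n}"
    hence k: "k \<le> n" by simp
    let ?I = "{..n} - {k}"
    define b where "b v = (\<Sum>j\<in>?I. v j * y ^ j) / y ^ k" for v :: "nat \<Rightarrow> complex"
    define G where "G x v = (\<Prod>j<k. indicator (- A) (v j)) * (indicator A x * neg_log (cmod (y ^ k) * cmod (x + b v)))"
      for x :: complex and v :: "nat \<Rightarrow> complex"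
    have comp [measurable]: "(\<lambda>v. v j) \<in> borel_measurable (\<Pi>\<^sub>M i\<in>?I. borel)" if "j \<in> ?I" for j
      using that by measurable
    have b_meas [measurable]: "b \<in> borel_measurable (\<Pi>\<^sub>M i\<in>?I. borel)"
      unfolding b_def by measurable
    have p_meas [measurable]: "(\<lambda>v. (\<Prod>j<k. indicator (- A) (v j)) :: ennreal) \<in> borel_measurable (\<Pi>\<^sub>M i\<in>?I. borel)"
      using k by (intro borel_measurable_prod_ennreal) (auto intro!: measurable_compose[OF comp] borel_measurable_indicator)
    have G_meas: "(\<lambda>(x, v). G x v) \<in> borel_measurable (borel \<Otimes>\<^sub>M (\<Pi>\<^sub>M i\<in>?I. borel))"
      unfolding G_def by measurable
    have FG: "F k \<omega> = G (X k \<omega>) (restrict (\<lambda>i. X i \<omega>) ?I)" for \<omega>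
    proof -
      have "(\<Sum>j\<le>n. X j \<omega> * y ^ j) = X k \<omega> * y ^ k + (\<Sum>j\<in>?I. X j \<omega> * y ^ j)"
        using k by (subst sum.remove[of _ k]) auto
      also have "\<dots> = y ^ k * (X k \<omega> + b (restrict (\<lambda>i. X i \<omega>) ?I))"
        using y by (simp add: b_def field_simps)
      finally have "(\<Sum>j\<le>n. X j \<omega> * y ^ j) = y ^ k * (X k \<omega> + b (restrict (\<lambda>i. X i \<omega>) ?I))" .
      moreover have "(\<Prod>j<k. indicator (- A) (restrict (\<lambda>i. X i \<omega>) ?I j)) = (\<Prod>j<k. indicator (- A) (X j \<omega>) :: ennreal)"
        using k by (intro prod.cong) auto
      ultimately show ?thesis by (simp add: F_def G_def norm_mult)
    qed
    have inner: "(\<integral>\<^sup>+x. G x v \<partial>distr M borel (X k)) \<le> (\<Prod>j<k. indicator (- A) (v j)) * ennreal (real k * a + ?J)" for v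
    proof -
      interpret D: prob_space "distr M borel (X k)" using k by (intro prob_space_distr) simp
      have "(\<integral>\<^sup>+x. indicator A x * neg_log (cmod (y ^ k) * cmod (x + b v)) \<partial>distr M borel (X k))
          \<le> (\<integral>\<^sup>+x. ennreal (real k * a) + indicator A x * neg_log (cmod (x + b v)) \<partial>distr M borel (X k))"
      proof (rule nn_integral_mono)
        fix x
        have "neg_log (cmod (y ^ k) * cmod (x + b v)) \<le> ennreal (- ln (cmod (y ^ k))) + neg_log (cmod (x + b v))"
          using y by (intro neg_log_mult_le) (auto simp: norm_power power_le_one)
        also have "- ln (cmod (y ^ k)) = real k * a" using y by (simp add: norm_power ln_realpow a_def)
        finally show "indicator A x * neg_log (cmod (y ^ k) * cmod (x + b v)) \<le> ennreal (real k * a) + indicator A x * neg_log (cmod (x + b v))"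
          by (cases "x \<in> A") auto
      qed
      also have "\<dots> = ennreal (real k * a) + (\<integral>\<^sup>+x. indicator A x * neg_log (cmod (x + b v)) \<partial>distr M borel (X k))"
        by (subst nn_integral_add) (auto simp: D.emeasure_space_1[simplified])
      also have "\<dots> \<le> ennreal (real k * a) + ennreal ?J"
        using K[OF k] by (intro add_left_mono nn_integral_neg_log_le K0) auto
      also have "\<dots> = ennreal (real k * a + ?J)" using a0 J0 by simp
      finally show ?thesis unfolding G_def
        by (subst nn_integral_cmult) (auto intro!: mult_left_mono)
    qed
    have "(\<integral>\<^sup>+\<omega>. F k \<omega> \<partial>M) \<le> (\<integral>\<^sup>+\<omega>. (\<Prod>j<k. indicator (- A) (restrict (\<lambda>i. X i \<omega>) ?I j)) * ennreal (real k * a + ?J) \<partial>M)"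
      unfolding FG using k by (subst nn_integral_indep_split[OF ind _ G_meas]) (simp, rule nn_integral_mono, rule inner)
    also have "\<dots> = (\<integral>\<^sup>+\<omega>. (\<Prod>j<k. indicator (- A) (X j \<omega>)) * ennreal (real k * a + ?J) \<partial>M)"
      using k by (intro nn_integral_cong arg_cong2[of _ _ _ _ "(*)"] prod.cong) auto
    also have "\<dots> = (\<integral>\<^sup>+\<omega>. (\<Prod>j<k. indicator (- A) (X j \<omega>)) \<partial>M) * ennreal (real k * a + ?J)"
      using k by (intro nn_integral_multc) auto
    also have "(\<integral>\<^sup>+\<omega>. (\<Prod>j<k. indicator (- A) (X j \<omega>)) \<partial>M) = (\<Prod>j<k. \<integral>\<^sup>+\<omega>. indicator (- A) (X j \<omega>) \<partial>M)"
    proof (rule indep_vars_nn_integral)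
      have "indep_vars (\<lambda>_. borel) X {..<k}" using k by (intro indep_vars_subset[OF ind]) auto
      thus "indep_vars (\<lambda>_. borel) (\<lambda>j \<omega>. indicator (- A) (X j \<omega>) :: ennreal) {..<k}"
        by (rule indep_vars_compose2) auto
    qed auto
    also have "\<dots> \<le> (\<Prod>j<k. ennreal q)"
    proof (rule prod_mono_ennreal)
      fix j assume "j \<in> {..<k}"
      hence j: "j \<le> n" using k by simp
      have "(\<integral>\<^sup>+\<omega>. indicator (- A) (X j \<omega>) \<partial>M) = (\<integral>\<^sup>+x. indicator (- A) x \<partial>distr M borel (X j))"
        using j by (subst nn_integral_distr) auto
      also have "\<dots> \<le> ennreal q" using q(1)[OF j] by (subst nn_integral_indicator) auto
      finally show "(\<integral>\<^sup>+\<omega>. indicator (- A) (X j \<omega>) \<partial>M) \<le> ennreal q" .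
    qed
    also have "(\<Prod>j<k. ennreal q) = ennreal (q ^ k)" using q by (simp add: ennreal_power)
    also have "ennreal (q ^ k) * ennreal (real k * a + ?J) = ennreal (q ^ k * (real k * a + ?J))"
      using q a0 J0 by (intro ennreal_mult[symmetric]) auto
    finally show "(\<integral>\<^sup>+\<omega>. F k \<omega> \<partial>M) \<le> ennreal (q ^ k * (real k * a + ?J))" by (simp add: mult_right_mono)
  qed
  also have "\<dots> = ennreal (\<Sum>k\<le>n. q ^ k * (real k * a + ?J))"
    using q a0 J0 by (intro sum_ennreal) auto
  also have "\<dots> \<le> ennreal ((a + ?J) / (1 - q) ^ 2)"
    using q a0 J0 by (intro ennreal_leI sum_geometric_deriv_le) auto
  finally show ?thesis by (simp add: a_def add.commute)
qed

text \<open>The sets where the density is at most \<open>m\<close> exhaust, up to a null set, the whole plane, since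
an integrable density is finite almost everywhere; so one of them has positive probability.\<close>

lemma (in prob_space) distributed_bounded_part:
  fixes X :: "'a \<Rightarrow> complex"
  assumes "distributed M lborel X f"
  obtains A K where "A \<in> sets borel" "0 \<le> K" "emeasure (distr M borel X) A > 0"
    "\<And>B. B \<in> sets borel \<Longrightarrow> emeasure (distr M borel X) (A \<inter> B) \<le> ennreal K * emeasure lborel B"
proof -
  have rv [measurable]: "random_variable borel X" and f [measurable]: "f \<in> borel_measurable borel"
    and dens: "distr M lborel X = density lborel f"
    using assms by (auto simp: distributed_def)
  have em: "emeasure (distr M borel X) B = (\<integral>\<^sup>+x. f x * indicator B x \<partial>lborel)" if "B \<in> sets borel" for B
  proof -
    have "emeasure (distr M borel X) B = emeasure (distr M lborel X) B"
      using that by (simp add: emeasure_distr)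
    thus ?thesis unfolding dens using that by (simp add: emeasure_density)
  qed
  interpret D: prob_space "distr M borel X" by (rule prob_space_distr) simp
  define A where "A m = {x. f x \<le> of_nat m}" for m :: nat
  have A [measurable]: "A m \<in> sets borel" for m unfolding A_def by measurable
  have "\<exists>m. emeasure (distr M borel X) (A m) > 0"
  proof (rule ccontr)
    assume "\<not> ?thesis"
    hence "A m \<in> null_sets (distr M borel X)" for m by (auto simp: null_sets_def)
    hence "(\<Union>m. A m) \<in> null_sets (distr M borel X)" by (rule null_sets_UN)
    hence *: "(\<integral>\<^sup>+x. f x * indicator (\<Union>m. A m) x \<partial>lborel) = 0" by (subst em[symmetric]) auto
    have one: "(\<integral>\<^sup>+x. f x \<partial>lborel) = 1" using em[of UNIV] D.emeasure_space_1 by simp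
    have "AE x in lborel. f x \<noteq> \<infinity>" by (rule nn_integral_PInf_AE) (auto simp: one)
    hence "AE x in lborel. f x = f x * indicator (\<Union>m. A m) x"
    proof eventually_elim
      case (elim x)
      hence "\<exists>m. f x < of_nat m" by (intro ennreal_Ex_less_of_nat) (simp add: less_top)
      hence "x \<in> (\<Union>m. A m)" unfolding A_def using less_imp_le by blast
      thus ?case by simp
    qed
    hence "(\<integral>\<^sup>+x. f x \<partial>lborel) = (\<integral>\<^sup>+x. f x * indicator (\<Union>m. A m) x \<partial>lborel)" by (rule nn_integral_cong_AE)
    with * one show False by simp
  qed
  then obtain m where m: "emeasure (distr M borel X) (A m) > 0" by blast
  show ?thesis
  proof (rule that[OF A _ m])
    fix B :: "complex set" assume [measurable]: "B \<in> sets borel"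
    have "emeasure (distr M borel X) (A m \<inter> B) = (\<integral>\<^sup>+x. f x * indicator (A m \<inter> B) x \<partial>lborel)" by (rule em) auto
    also have "\<dots> \<le> (\<integral>\<^sup>+x. of_nat m * indicator B x \<partial>lborel)"
      by (intro nn_integral_mono) (auto simp: indicator_def A_def)
    also have "\<dots> = of_nat m * emeasure lborel B" by (subst nn_integral_cmult) auto
    finally show "emeasure (distr M borel X) (A m \<inter> B) \<le> ennreal (real m) * emeasure lborel B"
      by (simp add: ennreal_of_nat_eq_real_of_nat)
  qed auto
qed

section \<open>Upper bound and reversal of polynomials\<close>

text \<open>The polynomial is at most \<open>n + 1\<close> times its largest coefficient times \<open>max(1, \<bar>z\<bar>) ^ n\<close>.
The logarithm of the largest coefficient is bounded through its \<open>t\<close>-th power and \<open>ln (x / (n + 1))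
\<le> x / (n + 1)\<close>; the point of the division by \<open>n + 1\<close> is that the sum of \<open>n + 1\<close> moments then has a
bounded expectation and the cost is only \<open>ln (n + 1)\<close>.\<close>

lemma log_norm_poly_le:
  fixes c :: "nat \<Rightarrow> complex"
  assumes "t > 0"
  shows "ln (cmod (\<Sum>k\<le>n. c k * z ^ k)) - real n * ln (max 1 (cmod z))
    \<le> ln (real n + 1) + ((\<Sum>k\<le>n. cmod (c k) powr t) / (real n + 1) + ln (real n + 1)) / t"
    (is "ln ?p - _ \<le> ?U")
proof -
  let ?X = "\<Sum>k\<le>n. cmod (c k) powr t" and ?m = "max 1 (cmod z)"
  have X0: "?X \<ge> 0" by (intro sum_nonneg) auto
  show ?thesis
  proof (cases "?p = 0")
    case True
    have "ln ?p - real n * ln ?m \<le> 0" using True by simp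
    also have "0 \<le> ?U" using X0 assms by simp
    finally show ?thesis .
  next
    case False
    obtain k where k: "k \<le> n" "\<And>j. j \<le> n \<Longrightarrow> cmod (c j) \<le> cmod (c k)"
    proof -
      have "Max ((\<lambda>j. cmod (c j)) ` {..n}) \<in> (\<lambda>j. cmod (c j)) ` {..n}" by (intro Max_in) auto
      then obtain k where "Max ((\<lambda>j. cmod (c j)) ` {..n}) = cmod (c k)" "k \<in> {..n}" by (rule imageE)
      moreover have "cmod (c j) \<le> Max ((\<lambda>j. cmod (c j)) ` {..n})" if "j \<le> n" for j
        using that by (intro Max_ge) auto
      ultimately show ?thesis by (intro that[of k]) auto
    qed
    have le: "?p \<le> (real n + 1) * (cmod (c k) * ?m ^ n)"
    proof -
      have "?p \<le> (\<Sum>j\<le>n. cmod (c k) * ?m ^ n)"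
      proof (rule sum_norm_le)
        fix j assume "j \<in> {..n}"
        hence j: "j \<le> n" by simp
        have "cmod z ^ j \<le> ?m ^ j" by (intro power_mono) auto
        also have "\<dots> \<le> ?m ^ n" using j by (intro power_increasing) auto
        finally show "cmod (c j * z ^ j) \<le> cmod (c k) * ?m ^ n"
          unfolding norm_mult norm_power using k(2)[OF j] by (intro mult_mono) auto
      qed
      thus ?thesis by (simp add: algebra_simps)
    qed
    have ck: "cmod (c k) > 0"
    proof (rule ccontr)
      assume "\<not> ?thesis" with le False show False by simp
    qed
    define x where "x = cmod (c k) powr t"
    have x: "0 < x" "x \<le> ?X"
      using ck k(1) member_le_sum[of k "{..n}" "\<lambda>k. cmod (c k) powr t"] by (auto simp: x_def)
    have "ln (x / (real n + 1)) \<le> x / (real n + 1) - 1" using x by (intro ln_le_minus_one) auto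
    moreover have "ln (x / (real n + 1)) = ln x - ln (real n + 1)" using x by (simp add: ln_div)
    moreover have "x / (real n + 1) \<le> ?X / (real n + 1)" using x by (intro divide_right_mono) auto
    ultimately have "ln x \<le> ?X / (real n + 1) + ln (real n + 1)" by linarith
    moreover have "ln x = t * ln (cmod (c k))" using ck by (simp add: x_def ln_powr)
    ultimately have lnc: "ln (cmod (c k)) \<le> (?X / (real n + 1) + ln (real n + 1)) / t"
      by (simp only: pos_le_divide_eq[OF assms] mult.commute[of _ t])
    have m: "?m > 0" by simp
    have "ln ?p \<le> ln ((real n + 1) * (cmod (c k) * ?m ^ n))"
      using le False by (intro ln_mono) (auto simp: less_le)
    also have "\<dots> = ln (real n + 1) + (ln (cmod (c k)) + real n * ln ?m)"
      using ck m by (simp only: ln_mult_pos ln_realpow mult_pos_pos zero_less_power of_nat_0_le_iff add_nonneg_pos zero_less_one)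
    finally show ?thesis using lnc by linarith
  qed
qed

lemma sum_reverse_powers:
  fixes c :: "nat \<Rightarrow> complex"
  assumes "z \<noteq> 0"
  shows "(\<Sum>k\<le>n. c k * z ^ k) = z ^ n * (\<Sum>j\<le>n. c (n - j) * (1 / z) ^ j)"
proof -
  have "(\<Sum>k\<le>n. c k * z ^ k) = (\<Sum>j\<le>n. c (n - j) * z ^ (n - j))"
    by (rule sum.reindex_bij_witness[of _ "\<lambda>i. n - i" "\<lambda>i. n - i"]) auto
  also have "\<dots> = (\<Sum>j\<le>n. z ^ n * (c (n - j) * (1 / z) ^ j))"
    using assms by (intro sum.cong) (auto simp: power_diff power_divide)
  finally show ?thesis by (simp add: sum_distrib_left)
qed

section \<open>Mean distance between the two potentials\<close>

text \<open>\<open>A\<close> is a set on which the common distribution of the coefficients has a density bounded by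
\<open>K\<close>, and \<open>q < 1\<close> bounds the probability that a coefficient misses it.\<close>

locale random_coefficients = prob_space +
  fixes C :: "nat \<Rightarrow> 'a \<Rightarrow> complex" and A :: "complex set" and K q t :: real
  assumes indep: "indep_vars (\<lambda>_. borel) C UNIV"
    and ident: "\<And>k. distr M borel (C k) = distr M borel (C 0)"
    and A [measurable]: "A \<in> sets borel"
    and K_nonneg: "0 \<le> K"
    and bounded_on_A: "\<And>B. B \<in> sets borel \<Longrightarrow>
        emeasure (distr M borel (C 0)) (A \<inter> B) \<le> ennreal K * emeasure lborel B"
    and prob_not_A: "emeasure (distr M borel (C 0)) (- A) \<le> ennreal q"
    and q: "0 \<le> q" "q < 1"
    and t: "0 < t"
    and moment: "integrable M (\<lambda>\<omega>. cmod (C 0 \<omega>) powr t)"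
begin

lemma rv [measurable]: "random_variable borel (C k)"
  using indep by (auto simp: indep_vars_def)

definition good :: "nat \<Rightarrow> 'a set" where
  "good n = {\<omega> \<in> space M. \<exists>k\<le>n. C k \<omega> \<in> A}"

lemma sets_good [measurable]: "good n \<in> events"
  unfolding good_def by measurable

lemma prob_not_good: "prob (space M - good n) \<le> q ^ (n + 1)"
proof -
  have "space M - good n = (\<Inter>k\<in>{..n}. C k -` (- A) \<inter> space M)" by (auto simp: good_def)
  also have "prob \<dots> = (\<Prod>k\<le>n. prob (C k -` (- A) \<inter> space M))"
    by (rule indep_varsD_finite[OF indep_vars_subset[OF indep]]) auto
  also have "\<dots> \<le> (\<Prod>k\<le>n. q)"
  proof (rule prod_mono)
    fix k
    have "emeasure (distr M borel (C k)) (- A) \<le> ennreal q" by (subst ident) (rule prob_not_A)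
    hence "ennreal (prob (C k -` (- A) \<inter> space M)) \<le> ennreal q"
      by (simp add: emeasure_distr emeasure_eq_measure)
    thus "0 \<le> prob (C k -` (- A) \<inter> space M) \<and> prob (C k -` (- A) \<inter> space M) \<le> q"
      using q by simp
  qed
  finally show ?thesis by simp
qed

definition excess :: "nat \<Rightarrow> 'a \<Rightarrow> complex \<Rightarrow> real" where
  "excess n \<omega> z = ln (cmod (poly (random_poly C n \<omega>) z)) - real n * ln (max 1 (cmod z))"

text \<open>For \<open>\<bar>z\<bar> \<le> 1\<close> the excess is \<open>ln \<bar>P z\<bar>\<close>. For \<open>\<bar>z\<bar> > 1\<close> it is the logarithm of \<open>\<bar>P z / z ^
n\<bar>\<close>, a polynomial in \<open>1 / z\<close> with the coefficients in reverse order, so both cases are instances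
of \<open>neg_log_random_sum_bound\<close>.\<close>

lemma nn_integral_neg_excess:
  assumes "z \<noteq> 0"
  shows "(\<integral>\<^sup>+\<omega>. indicator (good n) \<omega> * ennreal (- excess n \<omega> z) \<partial>M)
    \<le> ennreal ((log_const K + \<bar>ln (cmod z)\<bar>) / (1 - q) ^ 2)"
proof -
  note bd = neg_log_random_sum_bound[where A = A and K = K and q = q, OF _ A K_nonneg _ _ q]
  have hyps: "emeasure (distr M borel (C k)) (A \<inter> B) \<le> ennreal K * emeasure lborel B"
    "emeasure (distr M borel (C k)) (- A) \<le> ennreal q" if "B \<in> sets borel" for k B
    unfolding ident[of k] using bounded_on_A prob_not_A that by auto
  show ?thesis
  proof (cases "cmod z \<le> 1")
    case True
    have "(\<integral>\<^sup>+\<omega>. indicator (good n) \<omega> * ennreal (- excess n \<omega> z) \<partial>M)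
       \<le> (\<integral>\<^sup>+\<omega>. indicator {\<omega>. \<exists>k\<le>n. C k \<omega> \<in> A} \<omega> * neg_log (cmod (\<Sum>j\<le>n. C j \<omega> * z ^ j)) \<partial>M)"
      using True by (intro nn_integral_mono mult_mono)
        (auto simp: good_def excess_def poly_random_poly neg_log_def max_def indicator_def)
    also have "\<dots> \<le> ennreal ((log_const K - ln (cmod z)) / (1 - q) ^ 2)"
      using assms True hyps by (intro bd) (auto intro: indep_vars_subset[OF indep])
    finally show ?thesis using True assms by simp
  next
    case False
    have "(\<integral>\<^sup>+\<omega>. indicator (good n) \<omega> * ennreal (- excess n \<omega> z) \<partial>M)
       \<le> (\<integral>\<^sup>+\<omega>. indicator {\<omega>. \<exists>k\<le>n. C (n - k) \<omega> \<in> A} \<omega> *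
            neg_log (cmod (\<Sum>j\<le>n. C (n - j) \<omega> * (1 / z) ^ j)) \<partial>M)"
    proof (intro nn_integral_mono mult_mono)
      fix \<omega>
      show "indicator (good n) \<omega> \<le> (indicator {\<omega>. \<exists>k\<le>n. C (n - k) \<omega> \<in> A} \<omega> :: ennreal)"
      proof (cases "\<omega> \<in> good n")
        case True
        then obtain k where "k \<le> n" "C k \<omega> \<in> A" by (auto simp: good_def)
        hence "\<exists>k\<le>n. C (n - k) \<omega> \<in> A" by (intro exI[of _ "n - k"]) auto
        thus ?thesis by (simp add: indicator_def)
      qed simp
      let ?S = "\<Sum>j\<le>n. C (n - j) \<omega> * (1 / z) ^ j"
      have eq: "cmod (poly (random_poly C n \<omega>) z) = cmod z ^ n * cmod ?S"
        unfolding poly_random_poly sum_reverse_powers[OF assms] by (simp only: norm_mult norm_power)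
      show "ennreal (- excess n \<omega> z) \<le> neg_log (cmod ?S)"
      proof (cases "?S = 0")
        case nz: False
        have "ln (cmod z ^ n * cmod ?S) = real n * ln (cmod z) + ln (cmod ?S)"
          using nz assms by (subst ln_mult_pos) (auto simp: ln_realpow)
        hence "- excess n \<omega> z = - ln (cmod ?S)" using False unfolding excess_def eq by (simp add: max_def)
        thus ?thesis using nz by (simp add: neg_log_def)
      qed (simp add: neg_log_def)
    qed auto
    also have "\<dots> \<le> ennreal ((log_const K - ln (cmod (1 / z))) / (1 - q) ^ 2)"
    proof (rule bd)
      \<comment> \<open>Independence survives the reversal \<open>k \<mapsto> n - k\<close>, seen as regrouping into singletons.\<close>
      have "indep_vars (\<lambda>k. \<Pi>\<^sub>M i\<in>{n - k}. borel) (\<lambda>k \<omega>. restrict (\<lambda>i. C i \<omega>) {n - k}) {..n}"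
        by (rule indep_vars_restrict[OF indep]) (auto simp: disjoint_family_on_def)
      hence "indep_vars (\<lambda>_. borel) (\<lambda>k \<omega>. restrict (\<lambda>i. C i \<omega>) {n - k} (n - k)) {..n}"
        by (rule indep_vars_compose2) (rule measurable_component_singleton, simp)
      thus "indep_vars (\<lambda>_. borel) (\<lambda>k. C (n - k)) {..n}" by simp
    qed (use assms False hyps in \<open>auto simp: norm_divide\<close>)
    also have "- ln (cmod (1 / z)) = \<bar>ln (cmod z)\<bar>"
      using False assms by (simp add: norm_divide ln_div)
    hence "log_const K - ln (cmod (1 / z)) = log_const K + \<bar>ln (cmod z)\<bar>" by linarith
    finally show ?thesis .
  qed
qed

text \<open>The expectation of the upper bound in \<open>log_norm_poly_le\<close> for random coefficients.\<close>

definition log_bound :: "nat \<Rightarrow> real" where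
  "log_bound n = ln (real n + 1) + (expectation (\<lambda>\<omega>. cmod (C 0 \<omega>) powr t) + ln (real n + 1)) / t"

lemma moment_ident:
  "integrable M (\<lambda>\<omega>. cmod (C k \<omega>) powr t)"
  "expectation (\<lambda>\<omega>. cmod (C k \<omega>) powr t) = expectation (\<lambda>\<omega>. cmod (C 0 \<omega>) powr t)"
proof -
  have "integrable (distr M borel (C 0)) (\<lambda>x. cmod x powr t)"
    using moment by (subst integrable_distr_eq) auto
  thus "integrable M (\<lambda>\<omega>. cmod (C k \<omega>) powr t)"
    unfolding ident[of k, symmetric] by (subst (asm) integrable_distr_eq) auto
  have "expectation (\<lambda>\<omega>. cmod (C k \<omega>) powr t) = (LINT x|distr M borel (C k). cmod x powr t)" for k
    by (subst integral_distr) auto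
  thus "expectation (\<lambda>\<omega>. cmod (C k \<omega>) powr t) = expectation (\<lambda>\<omega>. cmod (C 0 \<omega>) powr t)"
    using ident[of k] by metis
qed

lemma log_bound_nonneg: "0 \<le> log_bound n"
  unfolding log_bound_def using t by (auto intro!: add_nonneg_nonneg divide_nonneg_pos)

lemma measurable_excess [measurable]: "(\<lambda>\<omega>. excess n \<omega> z) \<in> borel_measurable M"
  unfolding excess_def poly_random_poly by measurable

lemma nn_integral_excess:
  assumes "z \<noteq> 0"
  shows "(\<integral>\<^sup>+\<omega>. indicator (good n) \<omega> * ennreal \<bar>excess n \<omega> z\<bar> \<partial>M)
    \<le> ennreal (log_bound n + (log_const K + \<bar>ln (cmod z)\<bar>) / (1 - q) ^ 2)"
proof -
  define U where "U \<omega> = ln (real n + 1) + ((\<Sum>k\<le>n. cmod (C k \<omega>) powr t) / (real n + 1) + ln (real n + 1)) / t" for \<omega>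
  have U0: "U \<omega> \<ge> 0" for \<omega>
    unfolding U_def using t by (auto intro!: add_nonneg_nonneg divide_nonneg_pos sum_nonneg)
  have exU: "excess n \<omega> z \<le> U \<omega>" for \<omega>
    unfolding excess_def U_def poly_random_poly by (rule log_norm_poly_le[OF t])
  have intU: "integrable M U" unfolding U_def using moment_ident by auto
  have EU: "expectation U = log_bound n"
  proof -
    have "(\<Sum>k\<le>n. expectation (\<lambda>\<omega>. cmod (C k \<omega>) powr t)) = (\<Sum>k\<le>n. expectation (\<lambda>\<omega>. cmod (C 0 \<omega>) powr t))"
      by (intro sum.cong refl moment_ident(2))
    also have "\<dots> = (real n + 1) * expectation (\<lambda>\<omega>. cmod (C 0 \<omega>) powr t)" by (simp add: add.commute)
    finally show ?thesis unfolding U_def log_bound_def using moment_ident(1) by (simp add: prob_space)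
  qed
  have [measurable]: "U \<in> borel_measurable M" using intU by auto
  have "(\<integral>\<^sup>+\<omega>. indicator (good n) \<omega> * ennreal \<bar>excess n \<omega> z\<bar> \<partial>M)
     \<le> (\<integral>\<^sup>+\<omega>. ennreal (U \<omega>) + indicator (good n) \<omega> * ennreal (- excess n \<omega> z) \<partial>M)"
  proof (rule nn_integral_mono)
    fix \<omega>
    have "ennreal \<bar>excess n \<omega> z\<bar> \<le> ennreal (U \<omega>) + ennreal (- excess n \<omega> z)"
    proof (cases "excess n \<omega> z \<ge> 0")
      case True
      thus ?thesis using exU[of \<omega>] by (simp add: ennreal_neg ennreal_leI)
    next
      case False
      thus ?thesis by (simp add: add_increasing)
    qed
    thus "indicator (good n) \<omega> * ennreal \<bar>excess n \<omega> z\<bar>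
        \<le> ennreal (U \<omega>) + indicator (good n) \<omega> * ennreal (- excess n \<omega> z)"
      by (cases "\<omega> \<in> good n") auto
  qed
  also have "\<dots> = (\<integral>\<^sup>+\<omega>. ennreal (U \<omega>) \<partial>M) + (\<integral>\<^sup>+\<omega>. indicator (good n) \<omega> * ennreal (- excess n \<omega> z) \<partial>M)"
    by (intro nn_integral_add) auto
  also have "(\<integral>\<^sup>+\<omega>. ennreal (U \<omega>) \<partial>M) = ennreal (log_bound n)"
    using U0 intU EU by (subst nn_integral_eq_integral) auto
  also have "ennreal (log_bound n) + (\<integral>\<^sup>+\<omega>. indicator (good n) \<omega> * ennreal (- excess n \<omega> z) \<partial>M)
      \<le> ennreal (log_bound n) + ennreal ((log_const K + \<bar>ln (cmod z)\<bar>) / (1 - q) ^ 2)"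
    by (intro add_left_mono nn_integral_neg_excess assms)
  also have "\<dots> = ennreal (log_bound n + (log_const K + \<bar>ln (cmod z)\<bar>) / (1 - q) ^ 2)"
    using log_bound_nonneg log_const_nonneg[OF K_nonneg] by (intro ennreal_plus[symmetric]) auto
  finally show ?thesis .
qed

definition mean_excess :: "nat \<Rightarrow> 'a \<Rightarrow> complex \<Rightarrow> real \<Rightarrow> real" where
  "mean_excess n \<omega> w s = log_mean (random_poly C n \<omega>) w s - real n * log_plus_mean w s"

lemma measurable_mean_excess [measurable]: "(\<lambda>\<omega>. mean_excess n \<omega> w s) \<in> borel_measurable M"
  unfolding mean_excess_def using measurable_log_mean_random_poly[of C M, OF rv] by measurable

text \<open>The bound of \<open>nn_integral_excess\<close> averaged over a circle of radius at most \<open>2\<close> about a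
point of the unit circle. On it \<open>\<bar>z\<bar> \<le> 3\<close>, and \<open>\<bar>ln x\<bar> = 2 ln max(1, x) - ln x\<close>, where the last
term has a nonnegative mean; hence \<open>2 ln 3\<close>.\<close>

definition mean_bound :: "nat \<Rightarrow> real" where
  "mean_bound n = log_bound n + (log_const K + 2 * ln 3) / (1 - q) ^ 2"

lemma mean_bound_nonneg: "0 \<le> mean_bound n"
  using log_bound_nonneg log_const_nonneg[OF K_nonneg] by (auto simp: mean_bound_def)

text \<open>By Tonelli's theorem the pointwise bounds on the excess average over the circle. The
singular term \<open>\<bar>ln \<bar>z\<bar>\<bar>\<close>, which matters when the circle passes near the origin, has a bounded mean
by Jensen's formula.\<close>

lemma nn_integral_mean_excess:
  assumes w: "cmod w = 1" and s: "0 < s" "s \<le> 2"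
  shows "(\<integral>\<^sup>+\<omega>. indicator (good n) \<omega> * ennreal \<bar>mean_excess n \<omega> w s\<bar> \<partial>M) \<le> ennreal (mean_bound n)"
proof -
  interpret P: pair_prob_space M angle_measure ..
  let ?z = "\<lambda>u. w + of_real s * cis u"
  have z3: "cmod (?z u) \<le> 3" for u
    using norm_triangle_ineq[of w "of_real s * cis u"] w s by (simp add: norm_mult)
  have plus_le: "ln (max 1 (cmod (?z u))) \<le> ln 3" for u
    using z3[of u] by (intro ln_mono) auto
  have int_plus: "integrable angle_measure (\<lambda>u. ln (max 1 (cmod (?z u))))"
    using plus_le by (intro angle.integrable_const_bound[where B = "ln 3"]) auto
  have hb: "has_bochner_integral angle_measure (\<lambda>u. ln (cmod (?z u))) (ln (max s (cmod w)))"
    by (rule has_bochner_integral_log_norm_circle[OF s(1)])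
  \<comment> \<open>At \<open>x = 0\<close> both sides vanish, by \<open>ln 0 = 0\<close>.\<close>
  have abs_ln: "\<bar>ln (cmod x)\<bar> = 2 * ln (max 1 (cmod x)) - ln (cmod x)" for x
    by (cases "x = 0"; cases "cmod x \<le> 1") (auto simp: max_def)
  have int_abs: "integrable angle_measure (\<lambda>u. \<bar>ln (cmod (?z u))\<bar>)"
    using hb by (auto simp: has_bochner_integral_iff)
  have mean_abs: "(LINT u|angle_measure. \<bar>ln (cmod (?z u))\<bar>) \<le> 2 * ln 3"
  proof -
    have "(LINT u|angle_measure. \<bar>ln (cmod (?z u))\<bar>)
        = 2 * (LINT u|angle_measure. ln (max 1 (cmod (?z u)))) - ln (max s 1)"
      unfolding abs_ln using hb int_plus w by (simp add: has_bochner_integral_iff)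
    also have "(LINT u|angle_measure. ln (max 1 (cmod (?z u)))) \<le> (LINT u|angle_measure. ln 3)"
      using int_plus plus_le by (intro integral_mono) auto
    also have "(LINT u|angle_measure. ln 3) = ln 3" by (simp add: angle.prob_space[simplified])
    also have "2 * ln 3 - ln (max s 1) \<le> 2 * ln 3" by simp
    finally show ?thesis by simp
  qed
  have mean_eq: "mean_excess n \<omega> w s = (LINT u|angle_measure. excess n \<omega> (?z u))"
    and int_ex: "integrable angle_measure (\<lambda>u. excess n \<omega> (?z u))" for \<omega>
    unfolding mean_excess_def log_mean_def log_plus_mean_def excess_def
    using integrable_log_norm_poly[OF s(1), of "random_poly C n \<omega>" w] int_plus by auto
  have [measurable]: "(\<lambda>(\<omega>, u). excess n \<omega> (?z u)) \<in> borel_measurable (M \<Otimes>\<^sub>M angle_measure)"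
    unfolding excess_def poly_random_poly by measurable
  have "(\<integral>\<^sup>+\<omega>. indicator (good n) \<omega> * ennreal \<bar>mean_excess n \<omega> w s\<bar> \<partial>M)
      \<le> (\<integral>\<^sup>+\<omega>. (\<integral>\<^sup>+u. indicator (good n) \<omega> * ennreal \<bar>excess n \<omega> (?z u)\<bar> \<partial>angle_measure) \<partial>M)"
  proof (rule nn_integral_mono)
    fix \<omega>
    have "ennreal \<bar>mean_excess n \<omega> w s\<bar> \<le> (\<integral>\<^sup>+u. ennreal \<bar>excess n \<omega> (?z u)\<bar> \<partial>angle_measure)"
      using integral_norm_bound_ennreal[OF int_ex[of \<omega>]] by (simp add: mean_eq)
    thus "indicator (good n) \<omega> * ennreal \<bar>mean_excess n \<omega> w s\<bar>
        \<le> (\<integral>\<^sup>+u. indicator (good n) \<omega> * ennreal \<bar>excess n \<omega> (?z u)\<bar> \<partial>angle_measure)"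
      by (cases "\<omega> \<in> good n") auto
  qed
  also have "\<dots> = (\<integral>\<^sup>+u. (\<integral>\<^sup>+\<omega>. indicator (good n) \<omega> * ennreal \<bar>excess n \<omega> (?z u)\<bar> \<partial>M) \<partial>angle_measure)"
    by (rule P.Fubini'[symmetric]) measurable
  also have "\<dots> \<le> (\<integral>\<^sup>+u. ennreal (log_bound n + (log_const K + \<bar>ln (cmod (?z u))\<bar>) / (1 - q) ^ 2) \<partial>angle_measure)"
    using AE_circle_ne[OF s(1), of w] by (intro nn_integral_mono_AE) (auto elim!: eventually_mono intro: nn_integral_excess)
  also have "\<dots> = ennreal (LINT u|angle_measure. log_bound n + (log_const K + \<bar>ln (cmod (?z u))\<bar>) / (1 - q) ^ 2)"
    using int_abs log_bound_nonneg log_const_nonneg[OF K_nonneg]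
    by (intro nn_integral_eq_integral) auto
  also have "(LINT u|angle_measure. log_bound n + (log_const K + \<bar>ln (cmod (?z u))\<bar>) / (1 - q) ^ 2)
      = log_bound n + (log_const K + (LINT u|angle_measure. \<bar>ln (cmod (?z u))\<bar>)) / (1 - q) ^ 2"
    using int_abs by (simp add: angle.prob_space[simplified])
  also have "ennreal \<dots> \<le> ennreal (mean_bound n)"
    unfolding mean_bound_def using mean_abs by (intro ennreal_leI add_left_mono divide_right_mono) auto
  finally show ?thesis .
qed

lemma expectation_mean_excess:
  assumes w: "cmod w = 1" and s: "0 < s" "s \<le> 2"
  shows "integrable M (\<lambda>\<omega>. indicator (good n) \<omega> * \<bar>mean_excess n \<omega> w s\<bar>)"
    and "expectation (\<lambda>\<omega>. indicator (good n) \<omega> * \<bar>mean_excess n \<omega> w s\<bar>) \<le> mean_bound n"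
proof -
  have eq: "(\<integral>\<^sup>+\<omega>. ennreal (indicator (good n) \<omega> * \<bar>mean_excess n \<omega> w s\<bar>) \<partial>M)
      = (\<integral>\<^sup>+\<omega>. indicator (good n) \<omega> * ennreal \<bar>mean_excess n \<omega> w s\<bar> \<partial>M)"
    by (intro nn_integral_cong) (auto simp: indicator_def)
  note le = nn_integral_mean_excess[OF assms, of n]
  have int: "integrable M (\<lambda>\<omega>. indicator (good n) \<omega> * \<bar>mean_excess n \<omega> w s\<bar>)"
    using le by (intro integrableI_nonneg) (auto simp: eq intro: order.strict_trans1)
  thus "integrable M (\<lambda>\<omega>. indicator (good n) \<omega> * \<bar>mean_excess n \<omega> w s\<bar>)" .
  have "ennreal (expectation (\<lambda>\<omega>. indicator (good n) \<omega> * \<bar>mean_excess n \<omega> w s\<bar>)) \<le> ennreal (mean_bound n)"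
    using le nn_integral_eq_integral[OF int] by (simp add: eq)
  thus "expectation (\<lambda>\<omega>. indicator (good n) \<omega> * \<bar>mean_excess n \<omega> w s\<bar>) \<le> mean_bound n"
    using mean_bound_nonneg by simp
qed

lemma integrable_zero_count: "integrable M (\<lambda>\<omega>. real (zero_count (random_poly C n \<omega>) (ball w s)))"
proof (rule integrable_const_bound[where B = "real n"])
  show "AE \<omega> in M. norm (real (zero_count (random_poly C n \<omega>) (ball w s))) \<le> real n"
  proof (rule AE_I2)
    show "norm (real (zero_count (random_poly C n \<omega>) (ball w s))) \<le> real n" for \<omega>
      using zero_count_le[of "ball w s" C n \<omega>] by simp
  qed
qed (rule measurable_zero_count_random_poly[of C M, OF rv])

section \<open>From potentials to zero counts\<close>

text \<open>On the good event the difference of the Jensen means at radii \<open>s\<close> and \<open>s'\<close> is \<open>n\<close> times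
that of the uniform measure up to the mean excesses, so \<open>zero_count_log_mean\<close> and
\<open>log_plus_mean_diff\<close> compare the zero count with the arc share. Off it, \<open>0 \<le> N \<le> n\<close> costs \<open>n\<close>
times an exponentially small probability.\<close>

lemma expected_zero_count_bounds:
  fixes n :: nat
  assumes w: "cmod w = 1" and s: "0 < s'" "s' < s" "s < 2"
  defines "R \<equiv> 2 * mean_bound n / ln (s / s') + real n * q ^ (n + 1)"
  shows "expectation (\<lambda>\<omega>. real (zero_count (random_poly C n \<omega>) (ball w s'))) \<le> real n * arc_share s + R"
    and "real n * arc_share s' - R \<le> expectation (\<lambda>\<omega>. real (zero_count (random_poly C n \<omega>) (ball w s)))"
proof -
  define l where "l = ln (s / s')"
  have l: "l > 0" using s by (simp add: l_def)
  define Err where "Err \<omega> = (indicator (good n) \<omega> * \<bar>mean_excess n \<omega> w s\<bar> + indicator (good n) \<omega> * \<bar>mean_excess n \<omega> w s'\<bar>) / l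
      + real n * indicator (space M - good n) \<omega>" for \<omega>
  note E = expectation_mean_excess[OF w, of s n] expectation_mean_excess[OF w, of s' n]
  have bad: "integrable M (\<lambda>\<omega>. real n * indicator (space M - good n) \<omega>)"
    "expectation (\<lambda>\<omega>. real n * indicator (space M - good n) \<omega>) = real n * prob (space M - good n)"
  proof -
    show "integrable M (\<lambda>\<omega>. real n * indicator (space M - good n) \<omega>)"
      by (rule integrable_const_bound[where B = "real n"]) (auto simp: indicator_def)
    show "expectation (\<lambda>\<omega>. real n * indicator (space M - good n) \<omega>) = real n * prob (space M - good n)"
      by (simp only: integral_mult_right_zero Bochner_Integration.integral_indicator Int_absorb2[OF Diff_subset])
  qed
  hence int_Err: "integrable M Err" unfolding Err_def
    using E s by (intro Bochner_Integration.integrable_add integrable_divide) auto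
  have "expectation Err = (expectation (\<lambda>\<omega>. indicator (good n) \<omega> * \<bar>mean_excess n \<omega> w s\<bar>) +
      expectation (\<lambda>\<omega>. indicator (good n) \<omega> * \<bar>mean_excess n \<omega> w s'\<bar>)) / l + real n * prob (space M - good n)"
    unfolding Err_def using E(1,3) s bad
    by (subst Bochner_Integration.integral_add) (auto intro!: integrable_divide Bochner_Integration.integrable_add simp del: integral_mult_right_zero)
  also have "\<dots> \<le> (mean_bound n + mean_bound n) / l + real n * q ^ (n + 1)"
    using E s l prob_not_good[of n] by (intro add_mono divide_right_mono mult_left_mono) auto
  finally have Err_le: "expectation Err \<le> R" by (simp add: R_def l_def)
  have share: "0 \<le> arc_share x" "arc_share x \<le> 1" if "0 < x" "x < 2" for x
    using prob_arc[OF that] by (metis measure_nonneg) (metis prob_arc[OF that] angle.prob_le_1)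
  have diff: "log_mean (random_poly C n \<omega>) w s - log_mean (random_poly C n \<omega>) w s'
      = real n * (log_plus_mean w s - log_plus_mean w s') + mean_excess n \<omega> w s - mean_excess n \<omega> w s'" for \<omega>
    by (simp add: mean_excess_def algebra_simps)
  note m = log_plus_mean_diff[OF w s]
  have up: "real (zero_count (random_poly C n \<omega>) (ball w s')) \<le> real n * arc_share s + Err \<omega>"
    if "\<omega> \<in> space M" for \<omega>
  proof (cases "\<omega> \<in> good n")
    case True
    have "real (zero_count (random_poly C n \<omega>) (ball w s')) * l
        \<le> real n * (log_plus_mean w s - log_plus_mean w s') + mean_excess n \<omega> w s - mean_excess n \<omega> w s'"
      using zero_count_log_mean(1)[OF s(1,2), where p = "random_poly C n \<omega>" and w = w] by (simp add: diff l_def)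
    also have "\<dots> \<le> real n * (arc_share s * l) + (\<bar>mean_excess n \<omega> w s\<bar> + \<bar>mean_excess n \<omega> w s'\<bar>)"
      using mult_left_mono[OF m(2), of "real n"] by (simp add: l_def)
    finally show ?thesis using l True by (simp add: Err_def field_simps)
  next
    case False
    thus ?thesis using that share(1)[of s] s zero_count_le[of "ball w s'" C n \<omega>]
      by (simp add: Err_def add_increasing)
  qed
  have low: "real n * arc_share s' - Err \<omega> \<le> real (zero_count (random_poly C n \<omega>) (ball w s))"
    if "\<omega> \<in> space M" for \<omega>
  proof (cases "\<omega> \<in> good n")
    case True
    have "real n * (arc_share s' * l) - (\<bar>mean_excess n \<omega> w s\<bar> + \<bar>mean_excess n \<omega> w s'\<bar>)
        \<le> real n * (log_plus_mean w s - log_plus_mean w s') + mean_excess n \<omega> w s - mean_excess n \<omega> w s'"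
      using mult_left_mono[OF m(1), of "real n"] by (simp add: l_def)
    also have "\<dots> \<le> real (zero_count (random_poly C n \<omega>) (ball w s)) * l"
      using zero_count_log_mean(2)[OF s(1,2), where p = "random_poly C n \<omega>" and w = w] by (simp add: diff l_def)
    finally show ?thesis using l True by (simp add: Err_def field_simps)
  next
    case False
    have "real n * arc_share s' \<le> real n * 1" using share(2)[of s'] s by (intro mult_left_mono) auto
    thus ?thesis using that False by (simp add: Err_def)
  qed
  have "expectation (\<lambda>\<omega>. real (zero_count (random_poly C n \<omega>) (ball w s'))) \<le> expectation (\<lambda>\<omega>. real n * arc_share s + Err \<omega>)"
    using up int_Err by (intro integral_mono integrable_zero_count) auto
  also have "\<dots> = real n * arc_share s + expectation Err" using int_Err by (simp add: prob_space)
  finally show "expectation (\<lambda>\<omega>. real (zero_count (random_poly C n \<omega>) (ball w s'))) \<le> real n * arc_share s + R"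
    using Err_le by linarith
  have "real n * arc_share s' - R \<le> real n * arc_share s' - expectation Err" using Err_le by linarith
  also have "\<dots> = expectation (\<lambda>\<omega>. real n * arc_share s' - Err \<omega>)" using int_Err by (simp add: prob_space)
  also have "\<dots> \<le> expectation (\<lambda>\<omega>. real (zero_count (random_poly C n \<omega>) (ball w s)))"
    using low int_Err by (intro integral_mono integrable_zero_count) auto
  finally show "real n * arc_share s' - R \<le> expectation (\<lambda>\<omega>. real (zero_count (random_poly C n \<omega>) (ball w s)))" .
qed

text \<open>The radii \<open>r\<close> and \<open>r + h\<close> give the upper bound, \<open>r - h\<close> and \<open>r\<close> the lower one. Moving the
radius by \<open>h\<close> costs \<open>O(n h)\<close> since the arc share is differentiable at \<open>r < 2\<close>, and dividing the
mean excess by \<open>ln (s / s') \<ge> h / 2\<close> costs \<open>O(log n / h)\<close>; \<open>h = sqrt (log n / n)\<close> balances the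
two.\<close>

lemma expected_zero_count_asymptotics:
  assumes w: "cmod w = 1" and r: "0 < r" "r < 2"
  shows "(\<lambda>n. expectation (\<lambda>\<omega>. real (zero_count (random_poly C n \<omega>) (ball w r))) - arc_share r * real n)
    \<in> O(\<lambda>n. sqrt (real n * ln (real n)))"
proof -
  let ?E = "\<lambda>n. expectation (\<lambda>\<omega>. real (zero_count (random_poly C n \<omega>) (ball w r)))"
  obtain c where c: "eventually (\<lambda>h. arc_share (r + h) \<le> arc_share r + c * h \<and> arc_share r - c * h \<le> arc_share (r - h)) (at_right 0)"
    using arc_share_lipschitz[OF r] by blast
  define h where "h n = sqrt (ln (real n) / real n)" for n :: nat
  have h_lim: "filterlim h (at_right 0) sequentially" unfolding h_def by real_asymp
  define Q where "Q n = c * (real n * h n) + 4 * (mean_bound n / h n) + real n * q ^ (n + 1)" for n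
  have small: "eventually (\<lambda>h. h < min r (2 - r) \<and> 0 < h) (at_right (0::real))"
    using r by (intro eventually_conj eventually_at_right_less order_tendstoD(2)[OF tendsto_ident_at]) auto
  have "eventually (\<lambda>n. norm (?E n - arc_share r * real n) \<le> Q n) sequentially"
    using eventually_compose_filterlim[OF c h_lim] eventually_compose_filterlim[OF small h_lim]
  proof eventually_elim
    case (elim n)
    have ln_ge: "ln (x / y) \<ge> (x - y) / 2" if "0 < y" "y < x" "x < 2" for x y :: real
    proof -
      have "1 - y / x \<le> - ln (y / x)" using that ln_le_minus_one[of "y / x"] by simp
      also have "- ln (y / x) = ln (x / y)" using that by (simp add: ln_div)
      finally have "(x - y) / x \<le> ln (x / y)" using that by (simp add: field_simps)
      moreover have "(x - y) / 2 \<le> (x - y) / x" using that by (intro divide_left_mono) auto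
      ultimately show ?thesis by linarith
    qed
    have R_le: "2 * mean_bound n / ln (x / y) \<le> 4 * (mean_bound n / h n)" if "0 < y" "y < x" "x < 2" "x - y = h n" for x y
    proof -
      have "2 * mean_bound n / ln (x / y) \<le> 2 * mean_bound n / (h n / 2)"
        using ln_ge[OF that(1-3)] that elim mean_bound_nonneg by (intro divide_left_mono mult_pos_pos) auto
      thus ?thesis by simp
    qed
    have "?E n \<le> real n * arc_share (r + h n) + (2 * mean_bound n / ln ((r + h n) / r) + real n * q ^ (n + 1))"
      using elim r by (intro expected_zero_count_bounds(1)[OF w]) auto
    moreover have "real n * arc_share (r + h n) \<le> real n * (arc_share r + c * h n)"
      using elim by (intro mult_left_mono) auto
    moreover have "2 * mean_bound n / ln ((r + h n) / r) \<le> 4 * (mean_bound n / h n)"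
      using elim r by (intro R_le) auto
    ultimately have up: "?E n - arc_share r * real n \<le> Q n" by (simp add: Q_def algebra_simps)
    have "real n * arc_share (r - h n) - (2 * mean_bound n / ln (r / (r - h n)) + real n * q ^ (n + 1)) \<le> ?E n"
      using elim r by (intro expected_zero_count_bounds(2)[OF w]) auto
    moreover have "real n * (arc_share r - c * h n) \<le> real n * arc_share (r - h n)"
      using elim by (intro mult_left_mono) auto
    moreover have "2 * mean_bound n / ln (r / (r - h n)) \<le> 4 * (mean_bound n / h n)"
      using elim r by (intro R_le) auto
    ultimately have "- Q n \<le> ?E n - arc_share r * real n" by (simp add: Q_def algebra_simps)
    with up show ?case by (simp add: abs_le_iff)
  qed
  hence "(\<lambda>n. ?E n - arc_share r * real n) \<in> O(Q)"
    by (intro bigoI[of _ 1]) (auto elim!: eventually_mono)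
  also have "Q \<in> O(\<lambda>n. sqrt (real n * ln (real n)))"
  proof -
    have 1: "(\<lambda>n. real n * h n) \<in> O(\<lambda>n. sqrt (real n * ln (real n)))"
      unfolding h_def by real_asymp
    have 2: "(\<lambda>n. 1 / h n) \<in> O(\<lambda>n. sqrt (real n * ln (real n)))"
      unfolding h_def by real_asymp
    have 3: "(\<lambda>n. ln (real n + 1) / h n) \<in> O(\<lambda>n. sqrt (real n * ln (real n)))"
      unfolding h_def by real_asymp
    define a where "a = 1 + 1 / t"
    define b where "b = expectation (\<lambda>\<omega>. cmod (C 0 \<omega>) powr t) / t + (log_const K + 2 * ln 3) / (1 - q) ^ 2"
    have B: "mean_bound n / h n = a * (ln (real n + 1) / h n) + b * (1 / h n)" for n
      by (simp add: mean_bound_def log_bound_def a_def b_def add_divide_distrib algebra_simps)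
    have "(\<lambda>n. real n * q ^ n) \<longlonglongrightarrow> 0" using powser_times_n_limit_0[of q] q by simp
    hence "(\<lambda>n. real n * q ^ n) \<in> O(\<lambda>n. 1)" by (intro bigoI_tendsto[where c = 0]) auto
    moreover have "(\<lambda>n. 1) \<in> O(\<lambda>n. sqrt (real n * ln (real n)))" by real_asymp
    ultimately have "(\<lambda>n. real n * q ^ n) \<in> O(\<lambda>n. sqrt (real n * ln (real n)))" by (rule landau_o.big_trans)
    note 4 = this
    have scale: "(\<lambda>n. x * f n) \<in> O(g)" if "f \<in> O(g)" for x :: real and f g :: "nat \<Rightarrow> real"
      using that by (cases "x = 0") auto
    have Q: "Q = (\<lambda>n. c * (real n * h n) + ((4 * a) * (ln (real n + 1) / h n) + (4 * b) * (1 / h n)) + q * (real n * q ^ n))"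
      by (rule ext) (simp add: Q_def B algebra_simps)
    show ?thesis unfolding Q by (intro sum_in_bigo scale 1 2 3 4)
  qed
  finally show ?thesis .
qed

end

section \<open>The expected number of zeros in a disc\<close>

theorem proposition3p6:
  fixes M :: "'a measure" and C :: "nat \<Rightarrow> 'a \<Rightarrow> complex"
    and t r :: real and w :: complex
  assumes "prob_space M"
    and "iid_vars M borel C"
    and "\<exists>f. distributed M lborel (C 0) f"
    and "t > 0" and "integrable M (\<lambda>\<omega>. cmod (C 0 \<omega>) powr t)"
    and "w \<in> sphere 0 1" and "0 < r" and "r < 2"
  shows "(\<lambda>n. (\<integral>\<omega>. real n * measure (zeros_measure n (random_poly C n \<omega>)) (ball w r) \<partial>M)
            - 2 * arcsin (r / 2) / pi * real n)
         \<in> O(\<lambda>n. sqrt (real n * ln (real n)))"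
proof -
  interpret prob_space M by fact
  have indep: "indep_vars (\<lambda>_. borel) C UNIV" and ident: "\<And>k. distr M borel (C k) = distr M borel (C 0)"
    using assms(2) by (auto simp: iid_vars_def)
  obtain f where "distributed M lborel (C 0) f" using assms(3) by blast
  then obtain A K where A: "A \<in> sets borel" "0 \<le> K" "emeasure (distr M borel (C 0)) A > 0"
    and AK: "\<And>B. B \<in> sets borel \<Longrightarrow> emeasure (distr M borel (C 0)) (A \<inter> B) \<le> ennreal K * emeasure lborel B"
    by (rule distributed_bounded_part) blast
  have "random_variable borel (C 0)" using indep by (auto simp: indep_vars_def)
  then interpret D: prob_space "distr M borel (C 0)" by (rule prob_space_distr)
  define q where "q = D.prob (- A)"
  have "q = 1 - D.prob A" using D.prob_compl[of A] A(1) by (simp add: q_def Compl_eq_Diff_UNIV)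
  moreover have "D.prob A > 0" using A(3) by (simp add: D.emeasure_eq_measure)
  ultimately have "q < 1" by simp
  interpret random_coefficients M C A K q t
    by unfold_locales (use indep ident A AK assms \<open>q < 1\<close> in \<open>auto simp: q_def D.emeasure_eq_measure\<close>)
  have "eventually (\<lambda>n. (\<integral>\<omega>. real n * measure (zeros_measure n (random_poly C n \<omega>)) (ball w r) \<partial>M) - 2 * arcsin (r / 2) / pi * real n
      = expectation (\<lambda>\<omega>. real (zero_count (random_poly C n \<omega>) (ball w r))) - arc_share r * real n) sequentially"
    using eventually_gt_at_top[of 0] by eventually_elim (simp add: measure_zeros_measure arc_share_def)
  from landau_o.big.in_cong[OF this] show ?thesis
    using expected_zero_count_asymptotics[of w r] assms by simp
qed

end
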